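(* Let $(f_t)_{t\in I}$ be a decreasing Loewner chain in $\mathcal P^2$. Then the mapping $I\ni t\mapsto \mathrm m(f_t)\in\mathbb R$ is continuous, and the mapping $I\ni t\mapsto \rho_{f_t}\in\mathbf M(\mathbb R)$ is weakly continuous. In particular, $t\mapsto \mathrm r(f_t)=\rho_{f_t}(\mathbb R)$ is continuous.
   Context: $I$ is a fixed interval of the form $[0,T_0)$ with $0<T_0\le+\infty$ or $[0,T_0]$ with $0<T_0<+\infty$. $\mathbb C^+$ is the open upper half-plane; $\mathbf M(\mathbb R)$ is the set of finite nonnegative Borel measures on $\mathbb R$ and $\mathbf P(\mathbb R)$ the set of Borel probability measures on $\mathbb R$. Weak continuity is with respect to weak convergence of measures (tested against bounded continuous functions). For $\mu\in\mathbf P(\mathbb R)$ put $G_\mu(z)=\int_{\mathbb R}\frac{1}{z-x}\,\mu(dx)$ and $F_\mu=1/G_\mu$ on $\mathbb C^+$. Let $\mathcal P^2=\{F_\mu:\mu\in\mathbf P(\mathbb R),\ \int_{\mathbb R}x^2\,\mu(dx)<+\infty\}$. For each $f\in\mathcal P^2$ there is a unique pair $(\mathrm m(f),\rho_f)\in\mathbb R\times\mathbf M(\mathbb R)$ such that $f(z)=z-\mathrm m(f)+\int_{\mathbb R}\frac{1}{x-z}\,\rho_f(dx)$ for $z\in\mathbb C^+$; put $\mathrm r(f)=\rho_f(\mathbb R)$. A decreasing Loewner chain in $\mathcal P^2$ is a family $(f_t)_{t\in I}\subset\mathcal P^2$ of holomorphic functions on $\mathbb C^+$ such that each $f_t$ is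 univalent (injective), $f_0=\mathrm{id}$, $f_s(\mathbb C^+)\supset f_t(\mathbb C^+)$ whenever $s\le t$, and $t\mapsto f_t$ is continuous for the topology of locally uniform convergence on $\mathbb C^+$. *)

theory Defs
  imports "HOL-Probability.Probability" "HOL-Complex_Analysis.Complex_Analysis"
begin

definition upper_half_plane :: "complex set" where
  "upper_half_plane = {z. 0 < Im z}"

definition cauchy_transform :: "real measure \<Rightarrow> complex \<Rightarrow> complex" where
  "cauchy_transform \<mu> z = (LINT x|\<mu>. 1 / (z - complex_of_real x))"

definition reciprocal_cauchy_transform :: "real measure \<Rightarrow> complex \<Rightarrow> complex" where
  "reciprocal_cauchy_transform \<mu> z = 1 / cauchy_transform \<mu> z"

text \<open>Functions on the upper half-plane are total functions whose values elsewhere are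
  irrelevant; membership in the class therefore constrains the values on the upper half-plane only.\<close>

definition P2 :: "(complex \<Rightarrow> complex) set" where
  "P2 = {f. \<exists>\<mu>. real_distribution \<mu> \<and> integrable \<mu> (\<lambda>x. x\<^sup>2) \<and>
              (\<forall>z\<in>upper_half_plane. f z = reciprocal_cauchy_transform \<mu> z)}"

definition represents :: "(complex \<Rightarrow> complex) \<Rightarrow> real \<times> real measure \<Rightarrow> bool" where
  "represents f p \<longleftrightarrow> (case p of (m, \<rho>) \<Rightarrow> finite_borel_measure \<rho> \<and>
     (\<forall>z\<in>upper_half_plane.
        f z = z - complex_of_real m + (LINT x|\<rho>. 1 / (complex_of_real x - z))))"

text \<open>Every function in \<^const>\<open>P2\<close> has exactly one representing pair, which the
  definite descriptions below select.\<close>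

definition mean_of :: "(complex \<Rightarrow> complex) \<Rightarrow> real" where
  "mean_of f = fst (THE p. represents f p)"

definition rho_of :: "(complex \<Rightarrow> complex) \<Rightarrow> real measure" where
  "rho_of f = snd (THE p. represents f p)"

definition r_of :: "(complex \<Rightarrow> complex) \<Rightarrow> real" where
  "r_of f = measure (rho_of f) UNIV"

definition time_interval :: "real set \<Rightarrow> bool" where
  "time_interval I \<longleftrightarrow> I = {0..} \<or> (\<exists>T>0. I = {0..<T} \<or> I = {0..T})"

definition decreasing_loewner_chain_P2 ::
    "real set \<Rightarrow> (real \<Rightarrow> complex \<Rightarrow> complex) \<Rightarrow> bool" where
  "decreasing_loewner_chain_P2 I f \<longleftrightarrow>
     (\<forall>t\<in>I. f t \<in> P2 \<and> f t holomorphic_on upper_half_plane \<and> inj_on (f t) upper_half_plane) \<and>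
     (\<forall>z\<in>upper_half_plane. f 0 z = z) \<and>
     (\<forall>s\<in>I. \<forall>t\<in>I. s \<le> t \<longrightarrow> f t ` upper_half_plane \<subseteq> f s ` upper_half_plane) \<and>
     (\<forall>t\<in>I. \<forall>K. compact K \<and> K \<subseteq> upper_half_plane \<longrightarrow> uniform_limit K f (f t) (at t within I))"

text \<open>Continuity into the finite Borel measures with the weak topology, which is the initial
  topology of the integrals of bounded continuous functions. That the values are finite Borel
  measures is part of the notion.\<close>

definition weakly_continuous_on :: "real set \<Rightarrow> (real \<Rightarrow> real measure) \<Rightarrow> bool" where
  "weakly_continuous_on I \<rho> \<longleftrightarrow>
     (\<forall>t\<in>I. finite_borel_measure (\<rho> t)) \<and>
     (\<forall>g :: real \<Rightarrow> real. continuous_on UNIV g \<and> bounded (range g) \<longrightarrow>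
        continuous_on I (\<lambda>t. LINT x|\<rho> t. g x))"

end

theory Submission
  imports Defs
begin

text \<open>Pointwise convergence of \<open>f\<^sub>t\<close> controls the imaginary parts of the Stieltjes transforms of
\<open>\<rho>\<^sub>t\<close>, since \<open>Im (f\<^sub>t z) - Im z = Im (\<integral> 1/(x - z) \<rho>\<^sub>t(dx))\<close>, and these are integrals
of Poisson kernels. They determine integrals of compactly supported continuous functions up to
Poisson smoothing, so \<open>\<rho>\<^sub>s \<rightarrow> \<rho>\<^sub>t\<close> vaguely as soon as the masses stay bounded
(\<open>vague_convergence\<close>). The same argument applied to a constant sequence shows that the
representing pair is unique. What remains is to prevent mass from escaping to infinity, and this is
where the monotonicity of the ranges enters: univalence and pointwise convergence alone would allow
mass to disappear.

If \<open>s \<le> t\<close>, then \<open>f\<^sub>t = f\<^sub>s \<circ> \<phi>\<close> for a holomorphic self-map \<open>\<phi>\<close> of the half-plane,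
and \<open>\<phi>(z) - z\<close> has nonnegative imaginary part. By the Schwarz lemma \<open>y Im(\<phi>(iy) - iy)\<close> increases
with \<open>y\<close>, and its limit is \<open>r(f\<^sub>t) - r(f\<^sub>s)\<close> (\<open>subordination\<close>). Writing \<open>S\<^sub>t\<close> for the Stieltjes
transform of \<open>\<rho>\<^sub>t\<close>, this says
\<open>r(f\<^sub>s) - y Im (S\<^sub>s(\<phi>(iy))) \<le> r(f\<^sub>t) - y Im (S\<^sub>t(iy))\<close>. Both sides measure the mass far away from
the origin at scale \<open>y\<close>, so the tails of all \<open>\<rho>\<^sub>s\<close> with \<open>s \<le> t\<close> are dominated by a tail of
\<open>\<rho>\<^sub>t\<close> (\<open>subordinate_tail_le\<close>). The measures are therefore tight on the part of the chain before
any given time, and vague convergence becomes weak convergence. The masses converge because the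
constant function \<open>1\<close> is a test function, and the means because
\<open>m(f\<^sub>t) = Re (S\<^sub>t(i)) - Re (f\<^sub>t(i))\<close>.

The existence of the representing pair of a reciprocal Cauchy transform \<open>F\<close> is proved along the way.
Maassen's inequality \<open>|F(z) - z + m| \<le> \<sigma>\<^sup>2 / Im z\<close> (\<open>maassen_bound\<close>), with \<open>m\<close> the mean and
\<open>\<sigma>\<^sup>2\<close> the variance, places \<open>F(z) - z + m\<close> in the class of functions \<open>h\<close> with
\<open>Im h \<ge> 0\<close> and \<open>h = O(1 / Im z)\<close>. Poisson's formula on the lines \<open>Im z = e\<close> represents these
functions by measures of one and the same mass, which form a tight family; a weak limit for
\<open>e \<rightarrow> 0\<close> represents \<open>h\<close> (\<open>nevanlinna_representation\<close>).\<close>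

section \<open>Stieltjes transforms of finite measures\<close>

lemma Im_le_norm_of_real_minus: "Im z \<le> cmod (complex_of_real x - z)"
  using abs_Im_le_cmod[of "complex_of_real x - z"] by simp

text \<open>Without the usual factor \<open>1/\<pi>\<close>, so that the Poisson kernel is the imaginary part of the resolvent
\<open>1/(x - z)\<close>.\<close>

definition poisson_kernel :: "complex \<Rightarrow> real \<Rightarrow> real" where
  "poisson_kernel z x = Im z / ((x - Re z)\<^sup>2 + (Im z)\<^sup>2)"

definition stieltjes :: "real measure \<Rightarrow> complex \<Rightarrow> complex" where
  "stieltjes \<rho> z = (LINT x|\<rho>. 1 / (complex_of_real x - z))"

lemma norm_of_real_minus_squared: "(cmod (complex_of_real x - z))\<^sup>2 = (x - Re z)\<^sup>2 + (Im z)\<^sup>2"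
  by (simp add: cmod_power2)

lemma poisson_kernel_eq_Im:
  "poisson_kernel z x = Im (1 / (complex_of_real x - z))"
  by (simp add: poisson_kernel_def Im_divide power2_eq_square)

lemma of_real_minus_nonzero: "0 < Im z \<Longrightarrow> complex_of_real x - z \<noteq> 0"
  using Im_le_norm_of_real_minus[of z x] by auto

lemma norm_resolvent_le:
  assumes "0 < k" "k \<le> Im z"
  shows "cmod (1 / (complex_of_real x - z)) \<le> 1 / k"
  using assms Im_le_norm_of_real_minus[of z x] by (simp add: norm_divide frac_le)

lemma poisson_kernel_nonneg: "0 < Im z \<Longrightarrow> 0 \<le> poisson_kernel z x"
  by (simp add: poisson_kernel_def)

lemma poisson_kernel_le: "0 < Im z \<Longrightarrow> poisson_kernel z x \<le> 1 / Im z"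
  using norm_resolvent_le[of "Im z" z x] abs_Im_le_cmod[of "1 / (complex_of_real x - z)"]
  unfolding poisson_kernel_eq_Im by simp

lemma continuous_on_resolvent:
  "0 < Im z \<Longrightarrow> continuous_on A (\<lambda>x. 1 / (complex_of_real x - z))"
  by (intro continuous_intros) (use of_real_minus_nonzero in auto)

lemma continuous_on_poisson_kernel: "0 < Im z \<Longrightarrow> continuous_on A (poisson_kernel z)"
  unfolding poisson_kernel_def by (intro continuous_intros) (auto simp: sum_power2_eq_zero_iff)

lemma borel_measurable_poisson_kernel [measurable]:
  "poisson_kernel z \<in> borel_measurable borel"
  unfolding poisson_kernel_def by measurable

lemma finite_borel_measureI:
  assumes "finite_measure \<rho>" "sets \<rho> = sets borel"
  shows "finite_borel_measure \<rho>"
  using assms by (simp add: finite_borel_measure_def finite_borel_measure_axioms_def)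

context finite_borel_measure
begin

lemma borel_measurable_M: "f \<in> borel_measurable borel \<Longrightarrow> f \<in> borel_measurable M"
  using M_is_borel by (simp cong: measurable_cong_sets)

lemma integrable_bounded:
  fixes f :: "real \<Rightarrow> 'b :: {banach, second_countable_topology}"
  assumes "f \<in> borel_measurable borel" "\<And>x. norm (f x) \<le> B"
  shows "integrable M f"
  by (rule integrable_const_bound[of _ B]) (use assms borel_measurable_M in auto)

lemma norm_integral_bounded:
  fixes f :: "real \<Rightarrow> 'b :: {banach, second_countable_topology}"
  assumes "f \<in> borel_measurable borel" "\<And>x. norm (f x) \<le> B"
  shows "norm (integral\<^sup>L M f) \<le> measure M UNIV * B"
proof -
  have "norm (integral\<^sup>L M f) \<le> (LINT x|M. norm (f x))"
    by simp
  also have "\<dots> \<le> (LINT x|M. B)"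
    by (intro integral_mono integrable_norm integrable_bounded[OF assms])
       (use assms in auto)
  finally show ?thesis by (simp add: borel_UNIV)
qed

lemma integrable_poisson_kernel: "0 < Im z \<Longrightarrow> integrable M (poisson_kernel z)"
  by (rule integrable_bounded[where B = "1 / Im z"])
     (auto simp: poisson_kernel_le abs_of_nonneg poisson_kernel_nonneg)

lemma integrable_resolvent:
  "0 < Im z \<Longrightarrow> integrable M (\<lambda>x. 1 / (complex_of_real x - z))"
  by (rule integrable_bounded[where B = "1 / Im z"]) (auto intro: norm_resolvent_le)

lemma norm_stieltjes_le: "0 < k \<Longrightarrow> k \<le> Im z \<Longrightarrow> cmod (stieltjes M z) \<le> measure M UNIV / k"
  unfolding stieltjes_def
  using norm_integral_bounded[of "\<lambda>x. 1 / (complex_of_real x - z)" "1 / k"] norm_resolvent_le[of k z]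
  by auto

lemma Im_stieltjes: "0 < Im z \<Longrightarrow> Im (stieltjes M z) = integral\<^sup>L M (poisson_kernel z)"
  using integral_Im[OF integrable_resolvent, of z]
  by (simp add: stieltjes_def poisson_kernel_eq_Im[abs_def])

lemma Im_stieltjes_nonneg: "0 < Im z \<Longrightarrow> 0 \<le> Im (stieltjes M z)"
  by (simp add: Im_stieltjes poisson_kernel_nonneg)

text \<open>The resolvent identity. It yields both the derivative of the transform and its Lipschitz bound on
\<open>Im z \<ge> k\<close>.\<close>

lemma stieltjes_diff:
  assumes "0 < Im z" "0 < Im w"
  shows "stieltjes M w - stieltjes M z
           = (w - z) * (LINT x|M. 1 / ((complex_of_real x - w) * (complex_of_real x - z)))"
proof -
  have "stieltjes M w - stieltjes M z
      = (LINT x|M. 1 / (complex_of_real x - w) - 1 / (complex_of_real x - z))"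
    unfolding stieltjes_def using assms by (simp add: integrable_resolvent)
  also have "\<dots> = (LINT x|M. (w - z) * (1 / ((complex_of_real x - w) * (complex_of_real x - z))))"
    using of_real_minus_nonzero[OF assms(1)] of_real_minus_nonzero[OF assms(2)]
    by (intro Bochner_Integration.integral_cong) (auto simp: field_simps)
  finally show ?thesis by (simp only: integral_mult_right_zero)
qed

lemma norm_two_resolvents_le:
  assumes "0 < k" "k \<le> Im z" "k \<le> Im w"
  shows "cmod (1 / ((complex_of_real x - w) * (complex_of_real x - z))) \<le> 1 / k\<^sup>2"
proof -
  have "cmod (1 / (complex_of_real x - w)) * cmod (1 / (complex_of_real x - z)) \<le> (1/k) * (1/k)"
    using assms by (intro mult_mono norm_resolvent_le) auto
  then show ?thesis by (simp add: norm_divide norm_mult power2_eq_square)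
qed

lemma dist_stieltjes_le:
  assumes "0 < k" "k \<le> Im z" "k \<le> Im w"
  shows "cmod (stieltjes M w - stieltjes M z) \<le> measure M UNIV / k\<^sup>2 * cmod (w - z)"
proof -
  have "cmod (LINT x|M. 1 / ((complex_of_real x - w) * (complex_of_real x - z)))
      \<le> measure M UNIV * (1 / k\<^sup>2)"
    by (rule norm_integral_bounded) (use norm_two_resolvents_le[OF assms] in auto)
  from mult_left_mono[OF this, of "cmod (w - z)"] show ?thesis
    using assms by (simp add: stieltjes_diff norm_mult mult.commute)
qed

lemma holomorphic_stieltjes: "stieltjes M holomorphic_on upper_half_plane"
proof -
  have "\<exists>d. (stieltjes M has_field_derivative d) (at z)" if z: "0 < Im z" for z
  proof -
    let ?q = "\<lambda>w x. 1 / ((complex_of_real x - w) * (complex_of_real x - z))"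
    have "((\<lambda>w. (stieltjes M w - stieltjes M z) / (w - z)) \<longlongrightarrow> integral\<^sup>L M (?q z)) (at z)"
    proof (subst tendsto_at_iff_sequentially, intro allI impI)
      fix X assume X: "\<forall>i. X i \<in> UNIV - {z}" "X \<longlonglongrightarrow> z"
      have "\<forall>\<^sub>F i in sequentially. Im (X i) > Im z / 2"
        using order_tendstoD(1)[OF tendsto_Im[OF X(2)], of "Im z / 2"] z by simp
      then obtain N where N: "\<And>i. i \<ge> N \<Longrightarrow> Im (X i) > Im z / 2"
        by (auto simp: eventually_sequentially)
      have "(\<lambda>i. integral\<^sup>L M (?q (X (i + N)))) \<longlonglongrightarrow> integral\<^sup>L M (?q z)"
      proof (rule integral_dominated_convergence[where w = "\<lambda>_. 1 / (Im z / 2)\<^sup>2"])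
        show "AE x in M. (\<lambda>i. ?q (X (i + N)) x) \<longlonglongrightarrow> ?q z x"
          using of_real_minus_nonzero[OF z]
          by (intro AE_I2 tendsto_intros LIMSEQ_ignore_initial_segment X(2)) auto
        show "AE x in M. cmod (?q (X (i + N)) x) \<le> 1 / (Im z / 2)\<^sup>2" for i
          using z N[of "i + N"] by (intro AE_I2 norm_two_resolvents_le) auto
      qed (auto intro: borel_measurable_M)
      moreover have "integral\<^sup>L M (?q (X (i + N))) =
            ((\<lambda>w. (stieltjes M w - stieltjes M z) / (w - z)) \<circ> X) (i + N)" for i
      proof -
        have "0 < Im (X (i + N))" using N[of "i + N"] z by simp
        then show ?thesis using X(1) stieltjes_diff[OF z] by simp
      qed
      ultimately show "((\<lambda>w. (stieltjes M w - stieltjes M z) / (w - z)) \<circ> X) \<longlonglongrightarrow> integral\<^sup>L M (?q z)"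
        using LIMSEQ_offset[of "(\<lambda>w. (stieltjes M w - stieltjes M z) / (w - z)) \<circ> X" N] by simp
    qed
    then show ?thesis by (auto simp: has_field_derivative_iff)
  qed
  then show ?thesis
    unfolding holomorphic_on_def upper_half_plane_def field_differentiable_def
    by (blast intro: has_field_derivative_at_within)
qed

text \<open>The mass of the measure can be read off at infinity, along any sequence that stays within bounded
distance of the imaginary axis: \<open>y\<close> times the Poisson kernel tends to \<open>1\<close> pointwise, and it is
bounded by \<open>1\<close> because \<open>y \<le> Im w\<close>.\<close>

lemma stieltjes_asymptotics:
  assumes y: "filterlim y at_top sequentially" and C: "\<And>n. cmod (w n - \<i> * of_real (y n)) \<le> C"
    and le: "\<And>n. 0 < y n" "\<And>n. y n \<le> Im (w n)"
  shows "(\<lambda>n. y n * Im (stieltjes M (w n))) \<longlonglongrightarrow> measure M UNIV"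
proof -
  have pos: "0 < Im (w n)" for n using le[of n] by linarith
  have inv: "(\<lambda>n. C' / y n) \<longlonglongrightarrow> 0" for C'
    using y by (intro tendsto_divide_0[OF tendsto_const] filterlim_mono[OF y at_top_le_at_infinity order.refl])
  have bnd: "\<bar>Re (w n)\<bar> \<le> C" "\<bar>Im (w n) - y n\<bar> \<le> C" for n
    using abs_Re_le_cmod[of "w n - \<i> * of_real (y n)"] abs_Im_le_cmod[of "w n - \<i> * of_real (y n)"] C[of n]
    by simp_all
  have u: "(\<lambda>n. (x - Re (w n)) / y n) \<longlonglongrightarrow> 0" for x
  proof (rule tendsto_rabs_zero_cancel, rule tendsto_sandwich[OF _ _ tendsto_const inv])
    show "\<forall>\<^sub>F n in sequentially. 0 \<le> \<bar>(x - Re (w n)) / y n\<bar>" by simp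
    show "\<forall>\<^sub>F n in sequentially. \<bar>(x - Re (w n)) / y n\<bar> \<le> (\<bar>x\<bar> + C) / y n"
    proof (intro always_eventually allI)
      fix n
      have "\<bar>x - Re (w n)\<bar> \<le> \<bar>x\<bar> + C" using bnd(1)[of n] by linarith
      then show "\<bar>(x - Re (w n)) / y n\<bar> \<le> (\<bar>x\<bar> + C) / y n"
        using le(1)[of n] by (simp add: divide_right_mono)
    qed
  qed
  have v: "(\<lambda>n. Im (w n) / y n) \<longlonglongrightarrow> 1"
  proof -
    have "(\<lambda>n. (Im (w n) - y n) / y n) \<longlonglongrightarrow> 0"
    proof (rule tendsto_rabs_zero_cancel, rule tendsto_sandwich[OF _ _ tendsto_const inv])
      show "\<forall>\<^sub>F n in sequentially. \<bar>(Im (w n) - y n) / y n\<bar> \<le> C / y n"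
        using bnd(2) le(1) by (intro always_eventually allI)
          (auto simp: abs_divide abs_of_pos less_imp_le intro!: divide_right_mono)
    qed simp
    from tendsto_add[OF this tendsto_const[of 1]] show ?thesis
      using le(1) by (simp add: diff_divide_distrib less_imp_neq[symmetric])
  qed
  have "(\<lambda>n. LINT x|M. y n * poisson_kernel (w n) x) \<longlonglongrightarrow> (LINT x|M. 1)"
  proof (rule integral_dominated_convergence[where w = "\<lambda>_. 1"])
    have "(\<lambda>n. y n * poisson_kernel (w n) x) \<longlonglongrightarrow> 1" for x
    proof -
      have "y n * poisson_kernel (w n) x
          = (Im (w n) / y n) / (((x - Re (w n)) / y n)\<^sup>2 + (Im (w n) / y n)\<^sup>2)" for n
        using le(1)[of n] by (simp add: poisson_kernel_def power_divide add_divide_distrib[symmetric] power2_eq_square)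
      moreover have "(\<lambda>n. (Im (w n) / y n) / (((x - Re (w n)) / y n)\<^sup>2 + (Im (w n) / y n)\<^sup>2)) \<longlonglongrightarrow> 1 / (0\<^sup>2 + 1\<^sup>2)"
        by (intro tendsto_intros u v) auto
      ultimately show ?thesis by simp
    qed
    then show "AE x in M. (\<lambda>n. y n * poisson_kernel (w n) x) \<longlonglongrightarrow> 1" by simp
    have "norm (y n * poisson_kernel (w n) x) \<le> 1" for n x
    proof -
      have "y n * poisson_kernel (w n) x \<le> Im (w n) * (1 / Im (w n))"
        using le[of n] pos[of n] by (intro mult_mono poisson_kernel_le poisson_kernel_nonneg) auto
      then show ?thesis
        using le[of n] pos[of n] poisson_kernel_nonneg[OF pos, of n x] by simp
    qed
    then show "AE x in M. norm (y n * poisson_kernel (w n) x) \<le> 1" for n by simp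
  qed (auto intro: borel_measurable_M)
  then show ?thesis
    using pos by (simp add: Im_stieltjes borel_UNIV)
qed

end

section \<open>The Schwarz lemma along vertical lines\<close>

lemma cayley_less_1:
  assumes "0 < Im p" "0 < Im q"
  shows "cmod ((p - q) / (p - cnj q)) < 1"
proof -
  have "(cmod (p - q))\<^sup>2 < (cmod (p - cnj q))\<^sup>2"
    unfolding cmod_power2 using mult_pos_pos[OF assms] by (simp add: power2_eq_square algebra_simps)
  then have "cmod (p - q) < cmod (p - cnj q)"
    by (simp add: power_less_imp_less_base)
  then show ?thesis by (simp add: norm_divide divide_less_eq)
qed

text \<open>The Schwarz lemma for the map of the unit disc obtained from \<open>h\<close> by conjugating with the Cayley
transforms that send \<open>z0\<close> and \<open>h z0\<close> to the centre.\<close>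

lemma schwarz_pick:
  assumes hol: "h holomorphic_on upper_half_plane"
    and pos: "\<And>z. 0 < Im z \<Longrightarrow> 0 < Im (h z)" and z: "0 < Im z" and z0: "0 < Im z0"
  shows "cmod ((h z - h z0) / (h z - cnj (h z0))) \<le> cmod ((z - z0) / (z - cnj z0))"
proof -
  define T where "T \<zeta> = (z0 - cnj z0 * \<zeta>) / (1 - \<zeta>)" for \<zeta>
  define C where "C w = (w - h z0) / (w - cnj (h z0))" for w
  have T_pos: "0 < Im (T \<zeta>)" if "cmod \<zeta> < 1" for \<zeta>
  proof -
    have ne: "\<zeta> \<noteq> 1" using that by auto
    have "T \<zeta> = (z0 - cnj z0 * \<zeta>) * cnj (1 - \<zeta>) / of_real ((cmod (1 - \<zeta>))\<^sup>2)"
      unfolding T_def by (rule complex_div_cnj)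
    then have "Im (T \<zeta>) = Im ((z0 - cnj z0 * \<zeta>) * cnj (1 - \<zeta>)) / (cmod (1 - \<zeta>))\<^sup>2"
      by (simp add: Im_divide_of_real)
    also have "Im ((z0 - cnj z0 * \<zeta>) * cnj (1 - \<zeta>)) = Im z0 * (1 - (cmod \<zeta>)\<^sup>2)"
      unfolding cmod_power2 by (simp add: algebra_simps power2_eq_square)
    finally show ?thesis
      using that z0 ne by (simp add: power_less_one_iff)
  qed
  let ?f = "C \<circ> (h \<circ> T)"
  define \<xi> where "\<xi> = (z - z0) / (z - cnj z0)"
  have ne0: "z - cnj z0 \<noteq> 0" using z z0 by (auto simp: complex_eq_iff)
  have \<xi>: "cmod \<xi> < 1" unfolding \<xi>_def by (rule cayley_less_1[OF z z0])
  have T\<xi>: "T \<xi> = z"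
  proof -
    have "1 - \<xi> = (z0 - cnj z0) / (z - cnj z0)" "z0 - cnj z0 * \<xi> = z * (z0 - cnj z0) / (z - cnj z0)"
      unfolding \<xi>_def using ne0 by (simp_all add: field_simps)
    moreover have "z0 - cnj z0 \<noteq> 0" using z0 by (auto simp: complex_eq_iff)
    ultimately show ?thesis unfolding T_def using ne0 by simp
  qed
  have holf: "?f holomorphic_on ball 0 1"
  proof (intro holomorphic_on_compose_gen[where t = upper_half_plane])
    show "T holomorphic_on ball 0 1"
      unfolding T_def by (intro holomorphic_intros) auto
    show "T ` ball 0 1 \<subseteq> upper_half_plane" using T_pos by (auto simp: upper_half_plane_def)
    show "h holomorphic_on upper_half_plane" by fact
    show "C holomorphic_on upper_half_plane"
      unfolding C_def using pos[OF z0]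
      by (intro holomorphic_intros) (auto simp: upper_half_plane_def complex_eq_iff)
    show "(h \<circ> T) ` ball 0 1 \<subseteq> upper_half_plane"
      using T_pos pos by (auto simp: upper_half_plane_def)
  qed
  have "norm (?f \<xi>) \<le> norm \<xi>"
  proof (rule Schwarz_Lemma(1)[OF holf _ _ \<xi>])
    show "?f 0 = 0" by (simp add: C_def T_def)
    show "norm (?f \<zeta>) < 1" if "norm \<zeta> < 1" for \<zeta>
      using cayley_less_1[OF pos[OF T_pos[OF that]] pos[OF z0]] by (simp add: C_def)
  qed
  then show ?thesis by (simp add: T\<xi>) (simp add: C_def \<xi>_def)
qed

text \<open>The pseudo-hyperbolic distance between \<open>h(x + iy)\<close> and \<open>h(x + iy0)\<close> is at least that of their
imaginary parts placed on one vertical line, because discarding the difference \<open>d\<close> of the real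
parts only decreases it. Comparing \<open>|p - q| / (p + q)\<close> with \<open>(y - y0) / (y + y0)\<close> gives both
monotonicities at once.\<close>

lemma vertical_harnack_strict:
  assumes hol: "h holomorphic_on upper_half_plane"
    and pos: "\<And>z. 0 < Im z \<Longrightarrow> 0 < Im (h z)" and y: "0 < y0" "y0 \<le> y"
  shows "y0 * Im (h (Complex x y)) \<le> y * Im (h (Complex x y0))"
    and "y0 * Im (h (Complex x y0)) \<le> y * Im (h (Complex x y))"
proof -
  define p q where "p = Im (h (Complex x y))" and "q = Im (h (Complex x y0))"
  define d where "d = Re (h (Complex x y)) - Re (h (Complex x y0))"
  have p: "0 < p" and q: "0 < q" using pos y by (auto simp: p_def q_def)
  have "cmod ((h (Complex x y) - h (Complex x y0)) / (h (Complex x y) - cnj (h (Complex x y0))))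
     \<le> cmod ((Complex x y - Complex x y0) / (Complex x y - cnj (Complex x y0)))"
    by (rule schwarz_pick[OF hol pos]) (use y in auto)
  also have "\<dots> = (y - y0) / (y + y0)"
  proof -
    have "Complex x y - Complex x y0 = \<i> * of_real (y - y0)"
      "Complex x y - cnj (Complex x y0) = \<i> * of_real (y + y0)"
      by (simp_all add: complex_eq_iff)
    then show ?thesis using y by (simp only: norm_divide norm_mult norm_of_real) simp
  qed
  finally have le: "cmod ((h (Complex x y) - h (Complex x y0)) / (h (Complex x y) - cnj (h (Complex x y0))))
      \<le> (y - y0) / (y + y0)" .
  have "cmod (h (Complex x y) - h (Complex x y0)) * (y + y0)
      \<le> (y - y0) * cmod (h (Complex x y) - cnj (h (Complex x y0)))"
  proof -
    have "0 < cmod (h (Complex x y) - cnj (h (Complex x y0)))"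
      using p q by (auto simp: complex_eq_iff p_def q_def)
    then show ?thesis
      using le y by (simp add: norm_divide field_simps)
  qed
  then have "(cmod (h (Complex x y) - h (Complex x y0)) * (y + y0))\<^sup>2
      \<le> ((y - y0) * cmod (h (Complex x y) - cnj (h (Complex x y0))))\<^sup>2"
    using y by (intro power_mono) auto
  then have *: "(d\<^sup>2 + (p - q)\<^sup>2) * (y + y0)\<^sup>2 \<le> (y - y0)\<^sup>2 * (d\<^sup>2 + (p + q)\<^sup>2)"
    by (simp add: power_mult_distrib cmod_power2 p_def q_def d_def)
  have "((p - q) * (y + y0))\<^sup>2 \<le> ((y - y0) * (p + q))\<^sup>2"
  proof -
    have "(y - y0)\<^sup>2 \<le> (y + y0)\<^sup>2" using y by (intro power_mono) auto
    then have "d\<^sup>2 * (y - y0)\<^sup>2 \<le> d\<^sup>2 * (y + y0)\<^sup>2" by (intro mult_left_mono) auto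
    moreover have "d\<^sup>2 * (y + y0)\<^sup>2 + ((p - q) * (y + y0))\<^sup>2 \<le> d\<^sup>2 * (y - y0)\<^sup>2 + ((y - y0) * (p + q))\<^sup>2"
      using * unfolding power_mult_distrib by (simp add: distrib_left distrib_right mult.commute)
    ultimately show ?thesis by linarith
  qed
  then have "\<bar>(p - q) * (y + y0)\<bar> \<le> (y - y0) * (p + q)"
    using y p q by (simp add: abs_le_square_iff[symmetric])
  then have "y0 * p \<le> y * q" "y0 * q \<le> y * p"
    by (auto simp: abs_le_iff algebra_simps)
  then show "y0 * Im (h (Complex x y)) \<le> y * Im (h (Complex x y0))"
    and "y0 * Im (h (Complex x y0)) \<le> y * Im (h (Complex x y))"
    by (simp_all add: p_def q_def)
qed

text \<open>Along a vertical line \<open>Im h / y\<close> decreases and \<open>y Im h\<close> increases. Nonnegative imaginary parts are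
reduced to positive ones by adding \<open>ie\<close> and letting \<open>e\<close> tend to \<open>0\<close>.\<close>

lemma vertical_harnack:
  assumes hol: "h holomorphic_on upper_half_plane"
    and nonneg: "\<And>z. 0 < Im z \<Longrightarrow> 0 \<le> Im (h z)" and y: "0 < y0" "y0 \<le> y"
  shows "y0 * Im (h (Complex x y)) \<le> y * Im (h (Complex x y0))" (is ?A)
    and "y0 * Im (h (Complex x y0)) \<le> y * Im (h (Complex x y))" (is ?B)
proof -
  have *: "y0 * (Im (h (Complex x y)) + e) \<le> y * (Im (h (Complex x y0)) + e) \<and>
           y0 * (Im (h (Complex x y0)) + e) \<le> y * (Im (h (Complex x y)) + e)"
    if "0 < e" for e
  proof -
    have hol': "(\<lambda>z. h z + \<i> * of_real e) holomorphic_on upper_half_plane"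
      by (intro holomorphic_intros hol)
    have pos': "0 < Im (h z + \<i> * of_real e)" if "0 < Im z" for z
      using nonneg[OF that] \<open>0 < e\<close> by simp
    show ?thesis
      using vertical_harnack_strict[OF hol' pos' y, of x] by simp
  qed
  have "((\<lambda>e. y0 * (Im (h (Complex x y)) + e)) \<longlongrightarrow> y0 * (Im (h (Complex x y)) + 0)) (at_right 0)"
    "((\<lambda>e. y * (Im (h (Complex x y0)) + e)) \<longlongrightarrow> y * (Im (h (Complex x y0)) + 0)) (at_right 0)"
    by (intro tendsto_intros)+
  from tendsto_le[OF _ this(2,1)] * show ?A
    by (simp add: eventually_at_right_less eventually_mono[OF eventually_at_right_less])
  have "((\<lambda>e. y0 * (Im (h (Complex x y0)) + e)) \<longlongrightarrow> y0 * (Im (h (Complex x y0)) + 0)) (at_right 0)"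
    "((\<lambda>e. y * (Im (h (Complex x y)) + e)) \<longlongrightarrow> y * (Im (h (Complex x y)) + 0)) (at_right 0)"
    by (intro tendsto_intros)+
  from tendsto_le[OF _ this(2,1)] * show ?B
    by (simp add: eventually_at_right_less eventually_mono[OF eventually_at_right_less])
qed

section \<open>Maassen's inequality for reciprocal Cauchy transforms\<close>

lemma cauchy_transform_eq_stieltjes: "cauchy_transform \<mu> z = - stieltjes \<mu> z"
proof -
  have "(\<lambda>x. 1 / (z - complex_of_real x)) = (\<lambda>x. - (1 / (complex_of_real x - z)))"
    by (simp add: minus_divide_right)
  then show ?thesis
    by (simp only: cauchy_transform_def stieltjes_def Bochner_Integration.integral_minus)
qed

context real_distribution
begin

lemma prob_UNIV: "prob UNIV = 1"
  using prob_space by simp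

lemma Im_stieltjes_pos:
  assumes z: "0 < Im z"
  shows "0 < Im (stieltjes M z)"
proof -
  have pos: "0 < poisson_kernel z x" for x
    using z by (simp add: poisson_kernel_def add_nonneg_pos)
  have "integral\<^sup>L M (poisson_kernel z) \<noteq> 0"
  proof
    assume "integral\<^sup>L M (poisson_kernel z) = 0"
    then have "AE x in M. poisson_kernel z x = 0"
      using integral_nonneg_eq_0_iff_AE[OF integrable_poisson_kernel[OF z]] poisson_kernel_nonneg[OF z]
      by simp
    then have "AE x in M. False" using pos by (auto elim!: eventually_mono simp: less_le)
    then show False by simp
  qed
  then show ?thesis
    using Im_stieltjes[OF z] Im_stieltjes_nonneg[OF z] by linarith
qed

text \<open>The variance of the random variable \<open>1/(x - z)\<close>, whose second absolute moment is
\<open>Im S(z) / Im z\<close> for the Stieltjes transform \<open>S\<close>.\<close>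

lemma resolvent_variance:
  assumes z: "0 < Im z"
  shows "(LINT x|M. (cmod (1 / (complex_of_real x - z) - stieltjes M z))\<^sup>2)
           = Im (stieltjes M z) / Im z - (cmod (stieltjes M z))\<^sup>2"
proof -
  let ?a = "\<lambda>x. 1 / (complex_of_real x - z)" and ?S = "stieltjes M z"
  have eq: "(cmod (?a x - ?S))\<^sup>2 = poisson_kernel z x / Im z - 2 * (Re ?S * Re (?a x) + Im ?S * Im (?a x)) + (cmod ?S)\<^sup>2" for x
  proof -
    have "(cmod (?a x))\<^sup>2 = poisson_kernel z x / Im z"
      using z by (simp add: norm_divide power_divide norm_of_real_minus_squared poisson_kernel_def)
    moreover have "(cmod (?a x - ?S))\<^sup>2 = (cmod (?a x))\<^sup>2 - 2 * (Re ?S * Re (?a x) + Im ?S * Im (?a x)) + (cmod ?S)\<^sup>2"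
      unfolding cmod_power2 minus_complex.sel by (simp only: power2_diff) (simp only: algebra_simps)
    ultimately show ?thesis by simp
  qed
  have int: "integrable M ?a" by (rule integrable_resolvent[OF z])
  have "(LINT x|M. (cmod (?a x - ?S))\<^sup>2)
     = (LINT x|M. poisson_kernel z x) / Im z - 2 * (Re ?S * (LINT x|M. Re (?a x)) + Im ?S * (LINT x|M. Im (?a x)))
        + (cmod ?S)\<^sup>2"
    unfolding eq
    using integrable_poisson_kernel[OF z] integrable_Re[OF int] integrable_Im[OF int]
    by (simp add: prob_UNIV)
  also have "(LINT x|M. Re (?a x)) = Re ?S"
    unfolding stieltjes_def by (rule integral_Re[OF int])
  also have "(LINT x|M. Im (?a x)) = Im ?S"
    unfolding stieltjes_def by (rule integral_Im[OF int])
  finally show ?thesis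
    using z unfolding Im_stieltjes[OF z, symmetric] cmod_power2 by (simp add: power2_eq_square)
qed

text \<open>With \<open>a(x) = 1/(x - z)\<close> and \<open>S\<close> its expectation, \<open>h S\<close> is the covariance of \<open>m - x\<close> and \<open>a\<close>, and
the variance of \<open>a\<close> is \<open>|S|\<^sup>2 Im h / Im z\<close>; in particular \<open>Im h \<ge> 0\<close>. The inequality between
arithmetic and geometric means bounds the covariance, giving
\<open>|h| \<le> (\<sigma>\<^sup>2 / Im z + Im h) / 2\<close> for the variance \<open>\<sigma>\<^sup>2\<close> of \<open>x\<close>, and \<open>Im h \<le> |h|\<close> is absorbed
on the left.\<close>

lemma maassen_bound:
  fixes z :: complex
  assumes sq: "integrable M (\<lambda>x. x\<^sup>2)" and z: "0 < Im z"
  defines "m \<equiv> integral\<^sup>L M (\<lambda>x. x)"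
  defines "h \<equiv> - 1 / stieltjes M z - z + complex_of_real m"
  shows "0 \<le> Im h" and "cmod h \<le> (LINT x|M. (x - m)\<^sup>2) / Im z"
proof -
  let ?a = "\<lambda>x. 1 / (complex_of_real x - z)" and ?S = "stieltjes M z"
  let ?V = "LINT x|M. (cmod (?a x - ?S))\<^sup>2"
  have S: "0 < Im ?S" by (rule Im_stieltjes_pos[OF z])
  then have S0: "?S \<noteq> 0" by auto
  have V: "?V = (cmod ?S)\<^sup>2 * Im h / Im z"
  proof -
    have "Im h = Im ?S / (cmod ?S)\<^sup>2 - Im z"
      by (simp add: h_def Im_divide cmod_power2)
    then show ?thesis
      unfolding resolvent_variance[OF z] using S0 z by (simp add: field_simps)
  qed
  have "0 \<le> ?V" by simp
  then show Im_h: "0 \<le> Im h"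
    unfolding V using S0 z by (simp add: zero_le_mult_iff zero_le_divide_iff)
  have int_x: "integrable M (\<lambda>x. x)"
  proof (rule Bochner_Integration.integrable_bound[where f = "\<lambda>x. 1 + x\<^sup>2"])
    show "integrable M (\<lambda>x. 1 + x\<^sup>2)" using sq by simp
    have "\<bar>x\<bar> \<le> 1 + x\<^sup>2" for x :: real
      using sum_squares_ge_zero[of "\<bar>x\<bar> - 1" 0] by (simp add: power2_eq_square algebra_simps)
    then show "AE x in M. norm x \<le> norm (1 + x\<^sup>2)" by simp
  qed (auto intro: borel_measurable_M)
  have int_v: "integrable M (\<lambda>x. (x - m)\<^sup>2)"
    unfolding power2_diff using sq int_x by simp
  have int_a: "integrable M ?a" by (rule integrable_resolvent[OF z])
  have int_V: "integrable M (\<lambda>x. (cmod (?a x - ?S))\<^sup>2)"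
  proof (rule integrable_bounded[where B = "(1 / Im z + cmod ?S)\<^sup>2"])
    fix x
    have "cmod (?a x - ?S) \<le> 1 / Im z + cmod ?S"
      using norm_triangle_ineq4[of "?a x" ?S] norm_resolvent_le[OF z order.refl, of x] by linarith
    then show "norm ((cmod (?a x - ?S))\<^sup>2) \<le> (1 / Im z + cmod ?S)\<^sup>2"
      by (simp add: power_mono)
  qed simp
  have int_p: "integrable M (\<lambda>x. complex_of_real (m - x) * (?a x - ?S))"
  proof (rule Bochner_Integration.integrable_bound[where f = "\<lambda>x. (x - m)\<^sup>2 + (cmod (?a x - ?S))\<^sup>2"])
    have "\<bar>u\<bar> * v \<le> u\<^sup>2 + v\<^sup>2" if "0 \<le> v" for u v :: real
      using sum_squares_bound[of "\<bar>u\<bar>" v] zero_le_power2[of u] zero_le_power2[of v]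
        mult_nonneg_nonneg[OF abs_ge_zero[of u] that] by simp
    from this[of "cmod (?a x - ?S)" "x - m" for x]
    show "AE x in M. norm (complex_of_real (m - x) * (?a x - ?S)) \<le> norm ((x - m)\<^sup>2 + (cmod (?a x - ?S))\<^sup>2)"
      by (intro AE_I2) (simp add: norm_mult abs_minus_commute del: of_real_diff)
  qed (use int_v int_V in \<open>auto intro: borel_measurable_M\<close>)
  have hS: "h * ?S = (LINT x|M. complex_of_real (m - x) * (?a x - ?S))"
  proof -
    define a where "a = ?a"
    define k where "k x = complex_of_real (m - x)" for x
    have a: "integrable M a" "stieltjes M z = integral\<^sup>L M a"
      using int_a by (simp_all add: a_def stieltjes_def)
    have k: "integrable M k" unfolding k_def
      by (intro integrable_of_real Bochner_Integration.integrable_diff int_x) simp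
    have "k x * (a x - ?S) = - 1 + (of_real m - z) * a x - ?S * k x" for x
      using of_real_minus_nonzero[OF z, of x] by (simp add: a_def k_def field_simps)
    then have "(LINT x|M. k x * (a x - ?S)) = (LINT x|M. - 1 + (of_real m - z) * a x - ?S * k x)" by simp
    also have "\<dots> = - 1 + (of_real m - z) * ?S - ?S * integral\<^sup>L M k"
      using a k by (simp add: prob_UNIV)
    also have "integral\<^sup>L M k = 0"
    proof -
      have "integral\<^sup>L M k = of_real (LINT x|M. m - x)"
        unfolding k_def[abs_def]
        by (rule integral_of_real) (intro Bochner_Integration.integrable_diff int_x, simp)
      also have "(LINT x|M. m - x) = 0"
        using int_x by (subst Bochner_Integration.integral_diff) (auto simp: m_def prob_UNIV)
      finally show ?thesis by simp
    qed
    finally have "(LINT x|M. k x * (a x - ?S)) = - 1 + (of_real m - z) * ?S" by simp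
    moreover have "h * ?S = - 1 + (of_real m - z) * ?S"
      unfolding h_def using S0 by (simp add: field_simps)
    ultimately show ?thesis by (simp only: k_def a_def)
  qed
  have *: "cmod h * cmod ?S \<le> (cmod ?S / Im z * (LINT x|M. (x - m)\<^sup>2) + ?V * Im z / cmod ?S) / 2"
  proof -
    define \<kappa> where "\<kappa> = cmod ?S / Im z"
    have \<kappa>: "0 < \<kappa>" using S0 z by (simp add: \<kappa>_def)
    have "cmod h * cmod ?S \<le> (LINT x|M. cmod (complex_of_real (m - x) * (?a x - ?S)))"
      unfolding norm_mult[symmetric] hS by simp
    also have "\<dots> \<le> (LINT x|M. (\<kappa> * (x - m)\<^sup>2 + (cmod (?a x - ?S))\<^sup>2 / \<kappa>) / 2)"
    proof (rule integral_mono)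
      fix x
      define u v where "u = \<bar>x - m\<bar>" and "v = cmod (?a x - ?S)"
      have "2 * (\<kappa> * u) * v \<le> (\<kappa> * u)\<^sup>2 + v\<^sup>2" by (rule sum_squares_bound)
      then have "u * v \<le> (\<kappa> * u\<^sup>2 + v\<^sup>2 / \<kappa>) / 2"
        using \<kappa> by (simp add: field_simps power2_eq_square)
      then show "cmod (complex_of_real (m - x) * (?a x - ?S)) \<le> (\<kappa> * (x - m)\<^sup>2 + (cmod (?a x - ?S))\<^sup>2 / \<kappa>) / 2"
        by (simp add: u_def v_def norm_mult abs_minus_commute power2_commute[of x m] del: of_real_diff)
    qed (use int_p int_v int_V in \<open>auto intro: integrable_norm\<close>)
    also have "\<dots> = (\<kappa> * (LINT x|M. (x - m)\<^sup>2) + ?V / \<kappa>) / 2"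
      using int_v int_V by simp
    finally show ?thesis by (simp add: \<kappa>_def)
  qed
  have "cmod h * cmod ?S \<le> cmod ?S * (((LINT x|M. (x - m)\<^sup>2) / Im z + Im h) / 2)"
  proof -
    have "?V * Im z / cmod ?S = cmod ?S * Im h"
      unfolding V using S0 z by (simp add: power2_eq_square)
    then show ?thesis using * by (simp add: algebra_simps)
  qed
  then have "cmod h \<le> ((LINT x|M. (x - m)\<^sup>2) / Im z + Im h) / 2"
    using S0 by (simp add: mult.commute[of "cmod h"] mult_le_cancel_left_pos)
  moreover have "Im h \<le> cmod h" using abs_Im_le_cmod[of h] by simp
  ultimately show "cmod h \<le> (LINT x|M. (x - m)\<^sup>2) / Im z" by simp
qed

end

section \<open>Poisson's formula in the half-plane\<close>

lemma
  assumes z: "0 < Im z"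
  shows integrable_poisson_kernel_lborel: "integrable lborel (poisson_kernel z)"
    and integral_poisson_kernel_lborel: "integral\<^sup>L lborel (poisson_kernel z) = pi"
proof -
  let ?f = "\<lambda>x::real. inverse (1 + x\<^sup>2)"
  have f: "integrable lborel ?f" "integral\<^sup>L lborel ?f = pi"
    using integrable_inverse_1_plus_square LBINT_inverse_1_plus_square
    by (simp_all add: set_integrable_def interval_lebesgue_integral_def set_lebesgue_integral_def)
  have eq: "poisson_kernel z (Re z + Im z * x) = ?f x / Im z" for x
  proof -
    have "(Re z + Im z * x - Re z)\<^sup>2 + (Im z)\<^sup>2 = Im z * Im z * (1 + x\<^sup>2)"
      by (simp add: power2_eq_square algebra_simps)
    then show ?thesis using z by (simp add: poisson_kernel_def divide_inverse)
  qed
  have "integrable lborel (\<lambda>x. poisson_kernel z (Re z + Im z * x))"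
    unfolding eq using f by simp
  then show "integrable lborel (poisson_kernel z)"
    using z lborel_integrable_real_affine_iff[of "Im z" "poisson_kernel z" "Re z"] by simp
  show "integral\<^sup>L lborel (poisson_kernel z) = pi"
    using z f lborel_integral_real_affine[of "Im z" "poisson_kernel z" "Re z"] unfolding eq by simp
qed

text \<open>Cauchy's formula on the boundary of a half-disc for \<open>g(w) (z - cnj z) / (w - cnj z)\<close>, which agrees with
\<open>g\<close> at \<open>z\<close> and turns the Cauchy kernel on the real axis into the Poisson kernel. The integrand
decays quadratically on the arc. The winding number is kept as it is; its limit is found by taking
\<open>g = 1\<close> in \<open>poisson_formula\<close>.\<close>

lemma half_disc_poisson_estimate:
  fixes g :: "complex \<Rightarrow> complex"
  assumes \<epsilon>: "0 < \<epsilon>" and hol: "g holomorphic_on {w. - \<epsilon> < Im w}"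
    and bound: "\<And>w. 0 \<le> Im w \<Longrightarrow> cmod (g w) \<le> B"
    and z: "0 < Im z" and R: "cmod z < R"
  defines "\<gamma> \<equiv> linepath (- of_real R) (of_real R) +++ part_circlepath 0 R 0 pi"
  shows "cmod (winding_number \<gamma> z * g z - integral {- R..R} (\<lambda>x. of_real (poisson_kernel z x) * g (of_real x)) / pi)
           \<le> B * Im z * R / (R - cmod z)\<^sup>2"
proof -
  let ?L = "linepath (- of_real R) (of_real R) :: real \<Rightarrow> complex"
  let ?C = "part_circlepath 0 R 0 pi"
  have R0: "0 < R" using R norm_ge_zero[of z] by linarith
  have B0: "0 \<le> B" using order_trans[OF norm_ge_zero bound[of 0]] by simp
  \<comment> \<open>\<open>S\<close> reaches below the real axis, but not down to the second pole \<open>cnj z\<close>\<close>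
  define S where "S = {w. - min \<epsilon> (Im z) < Im w}"
  have S: "convex S" "open S"
    unfolding S_def by (rule convex_halfspace_Im_gt, rule open_halfspace_Im_gt)
  have zS: "z \<in> S" using z \<epsilon> by (simp add: S_def min_def)
  have up: "w \<in> S" if "0 \<le> Im w" for w using that z \<epsilon> by (simp add: S_def)
  define f where "f w = g w * (z - cnj z) / (w - cnj z)" for w
  have ne: "w - cnj z \<noteq> 0" if "w \<in> S" for w
    using that z by (auto simp: S_def complex_eq_iff)
  have holf: "f holomorphic_on S"
    unfolding f_def using ne
    by (intro holomorphic_intros holomorphic_on_subset[OF hol]) (auto simp: S_def)
  have imL: "w \<in> path_image ?L \<longleftrightarrow> (\<exists>x. w = of_real x \<and> \<bar>x\<bar> \<le> R)" for w
    using R0 closed_segment_of_real[of "- R" R, where 'a = complex]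
    by (auto simp: closed_segment_eq_real_ivl abs_le_iff)
  have imC: "cmod w = R \<and> 0 \<le> Im w" if w: "w \<in> path_image ?C" for w
  proof -
    obtain t :: real where t: "w = of_real R * cis t" "t \<in> closed_segment 0 pi"
      using w by (auto simp: path_image_part_circlepath')
    then have "0 \<le> sin t" by (auto simp: closed_segment_eq_real_ivl sin_ge_zero)
    then show ?thesis using t R0 by (simp add: norm_mult)
  qed
  have Lz: "path_image ?L \<subseteq> S - {z}" using up z by (auto simp: imL simp del: path_image_linepath)
  have Cz: "path_image ?C \<subseteq> S - {z}" using imC up R by auto
  let ?k = "\<lambda>w. f w / (w - z)"
  have cont: "continuous_on (S - {z}) ?k"
    by (intro continuous_intros continuous_on_subset[OF holomorphic_on_imp_continuous_on[OF holf]]) auto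
  have iL: "?k contour_integrable_on ?L"
    using continuous_on_subset[OF cont Lz] by (intro contour_integrable_continuous_linepath) simp
  have iC: "?k contour_integrable_on ?C"
    using continuous_on_subset[OF cont Cz] by (rule contour_integrable_continuous_part_circlepath)
  have "(?k has_contour_integral (2 * pi * \<i> * winding_number \<gamma> z * f z)) \<gamma>"
  proof (rule Cauchy_integral_formula_convex_simple[OF S(1) holf])
    show "z \<in> interior S" using S zS by (simp add: interior_open)
    show "valid_path \<gamma>" unfolding \<gamma>_def by (intro valid_path_join) auto
    show "path_image \<gamma> \<subseteq> S - {z}"
      unfolding \<gamma>_def using Lz Cz by (subst path_image_join) auto
    show "pathfinish \<gamma> = pathstart \<gamma>" by (simp add: \<gamma>_def)
  qed
  then have "contour_integral ?L ?k + contour_integral ?C ?k = 2 * pi * \<i> * winding_number \<gamma> z * f z"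
    unfolding \<gamma>_def using contour_integral_join[OF iL iC] contour_integral_unique by fastforce
  moreover have "f z = g z"
    using ne[OF zS] by (simp add: f_def)
  moreover have "contour_integral ?L ?k = 2 * \<i> * integral {- R..R} (\<lambda>x. of_real (poisson_kernel z x) * g (of_real x))"
  proof -
    have "?k (of_real x) = 2 * \<i> * (of_real (poisson_kernel z x) * g (of_real x))" for x :: real
    proof -
      have "(of_real x - cnj z) * (of_real x - z) = of_real ((x - Re z)\<^sup>2 + (Im z)\<^sup>2)"
        by (simp add: complex_eq_iff power2_eq_square)
      moreover have "z - cnj z = 2 * \<i> * of_real (Im z)" by (simp add: complex_eq_iff)
      ultimately show ?thesis
        by (simp add: f_def poisson_kernel_def)
    qed
    then show ?thesis using R0 by (simp add: contour_integral_linepath_Reals_eq)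
  qed
  ultimately have "contour_integral ?C ?k = 2 * pi * \<i> * winding_number \<gamma> z * g z
      - 2 * \<i> * integral {- R..R} (\<lambda>x. of_real (poisson_kernel z x) * g (of_real x))"
    by (simp only: eq_diff_eq add.commute)
  also have "\<dots> = 2 * pi * \<i> * (winding_number \<gamma> z * g z
      - integral {- R..R} (\<lambda>x. of_real (poisson_kernel z x) * g (of_real x)) / pi)"
    by (simp add: right_diff_distrib)
  finally have eq: "contour_integral ?C ?k = \<dots>" .
  define D where "D = winding_number \<gamma> z * g z
      - integral {- R..R} (\<lambda>x. of_real (poisson_kernel z x) * g (of_real x)) / pi"
  have "cmod (contour_integral ?C ?k) \<le> (B * (2 * Im z) / (R - cmod z)\<^sup>2) * R * \<bar>pi - 0\<bar>"
  proof (rule contour_integral_bound_part_circlepath[OF iC])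
    fix w assume "w \<in> path_image ?C"
    from imC[OF this] have w: "cmod w = R" "0 \<le> Im w" by auto
    have 1: "R - cmod z \<le> cmod (w - z)" using norm_triangle_ineq2[of w z] w by simp
    have 2: "R - cmod z \<le> cmod (w - cnj z)" using norm_triangle_ineq2[of w "cnj z"] w by simp
    have "z - cnj z = of_real (2 * Im z) * \<i>" by (simp add: complex_eq_iff)
    then have "cmod (z - cnj z) = 2 * Im z"
      using z by (simp only: norm_mult norm_of_real) simp
    then have "cmod (?k w) = cmod (g w) * (2 * Im z) / (cmod (w - cnj z) * cmod (w - z))"
      by (simp add: f_def norm_mult norm_divide)
    also have "\<dots> \<le> B * (2 * Im z) / ((R - cmod z) * (R - cmod z))"
      using R z 1 2 B0 bound[OF w(2)] by (intro frac_le mult_mono mult_nonneg_nonneg mult_pos_pos) auto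
    finally show "cmod (?k w) \<le> B * (2 * Im z) / (R - cmod z)\<^sup>2" by (simp add: power2_eq_square)
  qed (use B0 z R0 in auto)
  then have "2 * pi * cmod D \<le> 2 * pi * (B * Im z * R / (R - cmod z)\<^sup>2)"
    unfolding eq D_def[symmetric] by (simp add: norm_mult mult_ac)
  then show ?thesis
    unfolding D_def[symmetric] by (rule mult_left_le_imp_le) simp
qed

text \<open>The half-disc estimate for \<open>g = 1\<close> shows that the winding numbers tend to \<open>1\<close>, because the Poisson
kernel has integral \<open>\<pi>\<close>; the formula for general \<open>g\<close> follows by letting the radius tend to
infinity.\<close>

lemma poisson_formula:
  fixes g :: "complex \<Rightarrow> complex"
  assumes \<epsilon>: "0 < \<epsilon>" and hol: "g holomorphic_on {w. - \<epsilon> < Im w}"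
    and bound: "\<And>w. 0 \<le> Im w \<Longrightarrow> cmod (g w) \<le> B" and z: "0 < Im z"
  shows "integrable lborel (\<lambda>x. of_real (poisson_kernel z x) * g (of_real x))" (is "integrable lborel ?f")
    and "(LBINT x. of_real (poisson_kernel z x) * g (of_real x)) = pi * g z"
proof -
  define R where "R n = cmod z + 1 + real n" for n
  define N where "N n = winding_number (linepath (- of_real (R n)) (of_real (R n)) +++ part_circlepath 0 (R n) 0 pi) z" for n
  have R: "cmod z < R n" for n by (simp add: R_def)
  have err: "(\<lambda>n. B * Im z * R n / (R n - cmod z)\<^sup>2) \<longlonglongrightarrow> 0" for B
    unfolding R_def by real_asymp
  have trunc: "integrable lborel (\<lambda>x. of_real (poisson_kernel z x) * g (of_real x)) \<and>
      (\<lambda>n. N n * g z) \<longlonglongrightarrow> (LBINT x. of_real (poisson_kernel z x) * g (of_real x)) / pi"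
    if hol: "g holomorphic_on {w. - \<epsilon> < Im w}" and bound: "\<And>w. 0 \<le> Im w \<Longrightarrow> cmod (g w) \<le> B" for g :: "complex \<Rightarrow> complex" and B
  proof
    let ?f = "\<lambda>x. of_real (poisson_kernel z x) * g (of_real x)"
    have cont: "continuous_on UNIV (\<lambda>x::real. g (of_real x))"
      using \<epsilon> by (intro continuous_on_compose2[OF holomorphic_on_imp_continuous_on[OF hol]] continuous_intros) auto
    have meas[measurable]: "(\<lambda>x::real. g (of_real x)) \<in> borel_measurable borel"
      by (rule borel_measurable_continuous_onI[OF cont])
    show int: "integrable lborel ?f"
    proof (rule Bochner_Integration.integrable_bound[where f = "\<lambda>x. B * poisson_kernel z x"])
      show "AE x in lborel. cmod (?f x) \<le> norm (B * poisson_kernel z x)"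
      proof (intro AE_I2)
        fix x :: real
        have "0 \<le> B" using order_trans[OF norm_ge_zero bound[of 0]] by simp
        then show "cmod (?f x) \<le> norm (B * poisson_kernel z x)"
          using bound[of "of_real x"] poisson_kernel_nonneg[OF z, of x]
          by (simp add: norm_mult abs_mult mult.commute[of B] mult_left_mono)
      qed
    qed (use integrable_poisson_kernel_lborel[OF z] in auto)
    have "(\<lambda>n. LBINT x. indicator {- R n..R n} x *\<^sub>R ?f x) \<longlonglongrightarrow> integral\<^sup>L lborel ?f"
    proof (rule integral_dominated_convergence[where w = "\<lambda>x. norm (?f x)"])
      show "AE x in lborel. (\<lambda>n. indicator {- R n..R n} x *\<^sub>R ?f x) \<longlonglongrightarrow> ?f x"
      proof (intro AE_I2 tendsto_eventually)
        fix x :: real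
        obtain k :: nat where "\<bar>x\<bar> \<le> real k" using real_arch_simple by blast
        then have "x \<in> {- R n..R n}" if "n \<ge> k" for n
          using that norm_ge_zero[of z] unfolding R_def
          by (auto simp: abs_le_iff) (smt (verit) of_nat_mono norm_ge_zero)+
        then show "\<forall>\<^sub>F n in sequentially. indicator {- R n..R n} x *\<^sub>R ?f x = ?f x"
          by (auto simp: eventually_sequentially intro!: exI[of _ k])
      qed
    qed (use int in \<open>auto simp: indicator_def\<close>)
    moreover have "(LBINT x. indicator {- R n..R n} x *\<^sub>R ?f x) = integral {- R n..R n} ?f" for n
    proof -
      have "set_integrable lborel {- R n..R n} ?f"
        using int unfolding set_integrable_def by (rule integrable_mult_indicator[rotated]) simp
      from set_borel_integral_eq_integral(2)[OF this] show ?thesis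
        by (simp add: set_lebesgue_integral_def)
    qed
    ultimately have lim: "(\<lambda>n. integral {- R n..R n} ?f / pi) \<longlonglongrightarrow> integral\<^sup>L lborel ?f / pi"
      by (intro tendsto_intros) auto
    have "(\<lambda>n. N n * g z - integral {- R n..R n} ?f / pi) \<longlonglongrightarrow> 0"
    proof (rule Lim_null_comparison[OF _ err[of B]])
      show "\<forall>\<^sub>F n in sequentially. cmod (N n * g z - integral {- R n..R n} ?f / pi) \<le> B * Im z * R n / (R n - cmod z)\<^sup>2"
        unfolding N_def by (intro always_eventually allI half_disc_poisson_estimate[OF \<epsilon> hol bound z R])
    qed
    from tendsto_add[OF this lim] show "(\<lambda>n. N n * g z) \<longlonglongrightarrow> integral\<^sup>L lborel ?f / pi" by simp
  qed
  show "integrable lborel ?f" using trunc[OF hol bound] by blast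
  have "(\<lambda>n. N n * 1) \<longlonglongrightarrow> (LBINT x. of_real (poisson_kernel z x) * (1::complex)) / pi"
    using trunc[of "\<lambda>_. 1" 1] by simp
  also have "(LBINT x. of_real (poisson_kernel z x) * (1::complex)) / pi = 1"
    by (simp add: integral_poisson_kernel_lborel[OF z])
  finally have "N \<longlonglongrightarrow> 1" by simp
  then have "(\<lambda>n. N n * g z) \<longlonglongrightarrow> 1 * g z" by (intro tendsto_intros)
  then have "integral\<^sup>L lborel ?f / pi = g z"
    using trunc[OF hol bound] LIMSEQ_unique by fastforce
  then show "integral\<^sup>L lborel ?f = pi * g z" by (simp add: field_simps)
qed

section \<open>The Nevanlinna representation\<close>

context finite_borel_measure
begin

text \<open>The difference between the total mass and \<open>y Im S(w)\<close> is the integral of \<open>1\<close> minus a rescaled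
Poisson kernel. This function is nonnegative, and at least \<open>1/2\<close> outside the interval of radius
\<open>Im w\<close> about \<open>Re w\<close>, so Markov's inequality applies.\<close>

lemma tail_le_poisson_deficit:
  assumes y: "0 < y" "y \<le> Im w" and A: "\<bar>Re w\<bar> + Im w \<le> A"
  shows "measure M {x. A \<le> \<bar>x\<bar>} \<le> 2 * (measure M UNIV - y * Im (stieltjes M w))"
proof -
  have w: "0 < Im w" using y by linarith
  let ?u = "\<lambda>x. 1 - y * poisson_kernel w x"
  have u_ge: "(x - Re w)\<^sup>2 / ((x - Re w)\<^sup>2 + (Im w)\<^sup>2) \<le> ?u x" for x
  proof -
    have d: "0 < (x - Re w)\<^sup>2 + (Im w)\<^sup>2" using w by (simp add: add_nonneg_pos)
    have "y * Im w \<le> (Im w)\<^sup>2" using y w by (simp add: power2_eq_square)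
    then have "y * poisson_kernel w x \<le> (Im w)\<^sup>2 / ((x - Re w)\<^sup>2 + (Im w)\<^sup>2)"
      using d by (simp add: poisson_kernel_def divide_right_mono)
    moreover have "1 - (Im w)\<^sup>2 / ((x - Re w)\<^sup>2 + (Im w)\<^sup>2) = (x - Re w)\<^sup>2 / ((x - Re w)\<^sup>2 + (Im w)\<^sup>2)"
      using d w by (subst diff_eq_eq) (simp add: add_divide_distrib[symmetric])
    ultimately show ?thesis by linarith
  qed
  have int: "integrable M ?u"
    using integrable_poisson_kernel[OF w] by simp
  have u_nonneg: "0 \<le> ?u x" for x
    by (rule order_trans[OF _ u_ge]) simp
  have half: "1 / 2 \<le> ?u x" if "A \<le> \<bar>x\<bar>" for x
  proof -
    have "Im w \<le> \<bar>x - Re w\<bar>" using that A by linarith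
    then have "(Im w)\<^sup>2 \<le> (x - Re w)\<^sup>2" using w by (simp add: abs_le_square_iff[symmetric])
    moreover have "0 < (x - Re w)\<^sup>2 + (Im w)\<^sup>2" using w by (simp add: add_nonneg_pos)
    ultimately have "1 / 2 \<le> (x - Re w)\<^sup>2 / ((x - Re w)\<^sup>2 + (Im w)\<^sup>2)" by (simp add: field_simps)
    with u_ge[of x] show ?thesis by linarith
  qed
  have "measure M {x. A \<le> \<bar>x\<bar>} \<le> measure M {x \<in> space M. 1 / 2 \<le> ?u x}"
    using half by (intro finite_measure_mono) (auto simp: borel_UNIV M_is_borel)
  also have "\<dots> \<le> integral\<^sup>L M ?u / (1 / 2)"
    by (rule integral_Markov_inequality_measure[where A = "{}"]) (use int u_nonneg in auto)
  also have "integral\<^sup>L M ?u = measure M UNIV - y * Im (stieltjes M w)"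
    using integrable_poisson_kernel[OF w] by (simp add: Im_stieltjes[OF w] borel_UNIV)
  finally show ?thesis by simp
qed

end

lemma finite_borel_measure_density:
  fixes d :: "real \<Rightarrow> real"
  assumes M: "sets M = sets borel" and meas: "d \<in> borel_measurable borel"
    and nonneg: "\<And>x. 0 \<le> d x" and int: "integrable M d"
  shows "finite_borel_measure (density M d)"
    and "measure (density M d) UNIV = integral\<^sup>L M d"
proof -
  have sp: "space M = UNIV" using sets_eq_imp_space_eq[OF M] by simp
  have "emeasure (density M d) UNIV = (\<integral>\<^sup>+x. ennreal (d x) * indicator UNIV x \<partial>M)"
    using borel_measurable_integrable[OF int] M by (subst emeasure_density) auto
  then have e: "emeasure (density M d) UNIV = ennreal (integral\<^sup>L M d)"
    using nn_integral_eq_integral[OF int] nonneg by simp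
  show "finite_borel_measure (density M d)"
    by (rule finite_borel_measureI) (auto intro!: finite_measureI simp: e sp M)
  show "measure (density M d) UNIV = integral\<^sup>L M d"
    using nonneg by (simp add: measure_def e)
qed

lemma integral_poisson_kernel_density:
  fixes d :: "real \<Rightarrow> real"
  assumes "sets M = sets borel" "d \<in> borel_measurable borel" "\<And>x. 0 \<le> d x"
  shows "integral\<^sup>L (density M d) (poisson_kernel z) = (LINT x|M. d x * poisson_kernel z x)"
  using assms by (subst integral_density) (auto cong: measurable_cong_sets)

lemma real_valued_holomorphic_constant:
  assumes hol: "d holomorphic_on upper_half_plane" and real: "\<And>z. 0 < Im z \<Longrightarrow> Im (d z) = 0"
  shows "\<exists>c::real. \<forall>z\<in>upper_half_plane. d z = of_real c"
proof -
  have UHP: "open upper_half_plane" "connected upper_half_plane"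
    unfolding upper_half_plane_def
    by (simp_all add: open_halfspace_Im_gt convex_connected convex_halfspace_Im_gt)
  have i: "\<i> \<in> upper_half_plane" by (simp add: upper_half_plane_def)
  have "d constant_on upper_half_plane"
  proof (rule ccontr)
    assume "\<not> d constant_on upper_half_plane"
    then have "open (d ` upper_half_plane)"
      using open_mapping_thm[OF hol UHP UHP(1) order.refl] by blast
    then obtain e where e: "0 < e" "ball (d \<i>) e \<subseteq> d ` upper_half_plane"
      using i by (auto simp: open_contains_ball)
    have "d \<i> + \<i> * of_real (e / 2) \<in> ball (d \<i>) e"
      using e by (simp add: dist_norm norm_mult)
    then have "d \<i> + \<i> * of_real (e / 2) \<in> d ` upper_half_plane" using e(2) by blast
    then obtain z where z: "0 < Im z" "d \<i> + \<i> * of_real (e / 2) = d z"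
      by (auto simp: upper_half_plane_def simp del: of_real_divide)
    have "Im (d \<i> + \<i> * of_real (e / 2)) = 0" unfolding z(2) by (rule real[OF z(1)])
    then show False using real[of \<i>] e by simp
  qed
  then obtain c where c: "\<And>z. z \<in> upper_half_plane \<Longrightarrow> d z = c" by (auto simp: constant_on_def)
  then have "Im c = 0" using real[of \<i>] i by simp
  then have "d z = of_real (Re c)" if "z \<in> upper_half_plane" for z
    using c[OF that] by (simp add: complex_eq_iff)
  then show ?thesis by blast
qed

lemma tendsto_vertical_shift:
  assumes hol: "h holomorphic_on upper_half_plane" and z: "0 < Im z" and e: "e \<longlonglongrightarrow> 0" "\<And>n. 0 \<le> e n"
  shows "(\<lambda>n. h (z + \<i> * of_real (e n))) \<longlonglongrightarrow> h z"
proof (rule continuous_on_tendsto_compose[OF holomorphic_on_imp_continuous_on[OF hol]])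
  have "(\<lambda>n. z + \<i> * of_real (e n)) \<longlonglongrightarrow> z + \<i> * of_real 0"
    by (intro tendsto_intros e)
  then show "(\<lambda>n. z + \<i> * of_real (e n)) \<longlonglongrightarrow> z" by simp
qed (use z e in \<open>auto simp: upper_half_plane_def add_pos_nonneg\<close>)

text \<open>The function \<open>w \<mapsto> h(w + ie)\<close> is holomorphic across the real axis and bounded above it, as required by
Poisson's formula.\<close>

lemma shifted_poisson:
  fixes h :: "complex \<Rightarrow> complex"
  assumes hol: "h holomorphic_on upper_half_plane"
    and bound: "\<And>z. 0 < Im z \<Longrightarrow> cmod (h z) \<le> C / Im z" and C: "0 \<le> C"
    and e: "0 < e" and z: "0 < Im z"
  shows "integrable lborel (\<lambda>x. Im (h (of_real x + \<i> * of_real e)) * poisson_kernel z x)"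
    and "(LBINT x. Im (h (of_real x + \<i> * of_real e)) * poisson_kernel z x)
           = pi * Im (h (z + \<i> * of_real e))"
proof -
  let ?g = "\<lambda>w. h (w + \<i> * of_real e)"
  have hol': "?g holomorphic_on {w. - e < Im w}"
  proof -
    have "(\<lambda>w. w + \<i> * of_real e) holomorphic_on {w. - e < Im w}" by (intro holomorphic_intros)
    moreover have "(\<lambda>w. w + \<i> * of_real e) ` {w. - e < Im w} \<subseteq> upper_half_plane"
      by (auto simp: upper_half_plane_def)
    ultimately show ?thesis using holomorphic_on_compose_gen[OF _ hol] by (force simp: o_def)
  qed
  have bound': "cmod (?g w) \<le> C / e" if "0 \<le> Im w" for w
  proof -
    have "cmod (?g w) \<le> C / Im (w + \<i> * of_real e)" using that e by (intro bound) simp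
    also have "\<dots> \<le> C / e" using that e C by (intro divide_left_mono) auto
    finally show ?thesis .
  qed
  note P = poisson_formula[OF e hol' bound' z]
  have Im_eq: "Im (of_real (poisson_kernel z x) * ?g (of_real x)) = Im (?g (of_real x)) * poisson_kernel z x" for x
    by simp
  show "integrable lborel (\<lambda>x. Im (?g (of_real x)) * poisson_kernel z x)"
    using integrable_Im[OF P(1)] unfolding Im_eq .
  show "(LBINT x. Im (?g (of_real x)) * poisson_kernel z x) = pi * Im (?g z)"
    using integral_Im[OF P(1)] P(2) unfolding Im_eq by simp
qed

text \<open>The measures with densities \<open>d e x / \<pi>\<close>, where \<open>d e x = Im h(x + ie)\<close>, represent the imaginary part of
\<open>h(z + ie)\<close>. By monotone convergence along \<open>z = iy\<close>, \<open>y \<rightarrow> \<infinity>\<close>, all of them have the mass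
\<open>r = lim y Im h(iy)\<close>. The tails are estimated by \<open>r - y Im h(i(y + e))\<close>, which is small
uniformly in \<open>e \<le> 1\<close> when \<open>y\<close> is large. Unless \<open>r = 0\<close>, the measures can be normalised and a
subsequence converges weakly; the limit represents \<open>Im h\<close>, and this fixes \<open>h\<close> up to a real
constant.\<close>

theorem nevanlinna_representation:
  fixes h :: "complex \<Rightarrow> complex"
  assumes hol: "h holomorphic_on upper_half_plane"
    and nonneg: "\<And>z. 0 < Im z \<Longrightarrow> 0 \<le> Im (h z)"
    and bound: "\<And>z. 0 < Im z \<Longrightarrow> cmod (h z) \<le> C / Im z"
  shows "\<exists>\<rho> c. finite_borel_measure \<rho> \<and>
           (\<forall>z\<in>upper_half_plane. h z = stieltjes \<rho> z + complex_of_real c)"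
proof -
  have C: "0 \<le> C" using order_trans[OF norm_ge_zero bound[of \<i>]] by simp
  have Im_bound: "Im (h z) \<le> C / Im z" if "0 < Im z" for z
    using abs_Im_le_cmod[of "h z"] bound[OF that] by linarith
  define u where "u y = y * Im (h (Complex 0 y))" for y
  have u_mono: "u y0 \<le> u y" if "0 < y0" "y0 \<le> y" for y y0
    unfolding u_def by (rule vertical_harnack(2)[OF hol nonneg that])
  have u_le: "u y \<le> C" if "0 < y" for y
    using Im_bound[of "Complex 0 y"] that by (simp add: u_def field_simps)
  obtain r where r: "(\<lambda>n. u (Suc n)) \<longlonglongrightarrow> r" and r_ge: "\<And>n. u (Suc n) \<le> r"
    by (rule incseq_convergent[of "\<lambda>n. u (Suc n)" C])
       (auto simp: incseq_def intro!: u_mono u_le)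
  have r0: "0 \<le> r"
    using r_ge[of 0] nonneg[of "Complex 0 1"] by (simp add: u_def)

  define d where "d e x = Im (h (of_real x + \<i> * of_real e))" for e x :: real
  have d_nonneg: "0 \<le> d e x" if "0 < e" for e x
    unfolding d_def using that by (intro nonneg) simp
  have d_meas: "d e \<in> borel_measurable borel" if "0 < e" for e
  proof (rule borel_measurable_continuous_onI)
    show "continuous_on UNIV (d e)" unfolding d_def
      using that by (intro continuous_intros continuous_on_compose2[OF holomorphic_on_imp_continuous_on[OF hol]])
        (auto simp: upper_half_plane_def)
  qed
  note dP = shifted_poisson[OF hol bound C, folded d_def]

  \<comment> \<open>\<open>y\<close> times the Poisson kernel at \<open>iy\<close> increases to \<open>1\<close>\<close>
  have mass: "integrable lborel (d e) \<and> integral\<^sup>L lborel (d e) = pi * r" if e: "0 < e" for e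
  proof -
    let ?f = "\<lambda>n x. d e x * (real (Suc n) * poisson_kernel (Complex 0 (Suc n)) x)"
    have k: "real (Suc n) * poisson_kernel (Complex 0 (Suc n)) x = 1 / ((x / real (Suc n))\<^sup>2 + 1)" for n x
    proof -
      have "s * (s / (x\<^sup>2 + s\<^sup>2)) = 1 / ((x / s)\<^sup>2 + 1)" if "0 < s" for s :: real
      proof -
        have "(x / s)\<^sup>2 + 1 = (x\<^sup>2 + s\<^sup>2) / s\<^sup>2"
          using that by (simp add: power_divide add_divide_distrib)
        then show ?thesis by (simp add: power2_eq_square)
      qed
      from this[of "real (Suc n)"] show ?thesis by (simp add: poisson_kernel_def del: of_nat_Suc)
    qed
    have pos: "0 < Im (Complex 0 (real (Suc n)))" for n by simp
    have int: "integrable lborel (?f n)" for n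
      using integrable_mult_right[OF dP(1)[OF _ e pos], of "real (Suc n)"]
      by (simp add: mult_ac del: of_nat_Suc)
    have val: "integral\<^sup>L lborel (?f n) = pi * (real (Suc n) * Im (h (Complex 0 (real (Suc n) + e))))" for n
    proof -
      have "integral\<^sup>L lborel (?f n) = real (Suc n) * (LBINT x. d e x * poisson_kernel (Complex 0 (Suc n)) x)"
        by (subst integral_mult_right_zero[symmetric]) (simp only: mult_ac)
      moreover have "Complex 0 (real (Suc n)) + \<i> * of_real e = Complex 0 (real (Suc n) + e)"
        by (simp add: complex_eq_iff)
      ultimately show ?thesis using dP(2)[OF _ e pos, of n] by (simp del: of_nat_Suc)
    qed
    have lim: "(\<lambda>n. real (Suc n) * Im (h (Complex 0 (real (Suc n) + e)))) \<longlonglongrightarrow> r"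
    proof (rule tendsto_sandwich)
      \<comment> \<open>the shift by \<open>e\<close> lowers \<open>y Im h(iy)\<close> by at most \<open>e C / y\<close>\<close>
      show "(\<lambda>n. u (Suc n) - e * (C / Suc n)) \<longlonglongrightarrow> r"
      proof -
        have "(\<lambda>n. e * (C / real (Suc n))) \<longlonglongrightarrow> 0" by real_asymp
        from tendsto_diff[OF r this] show ?thesis by simp
      qed
      have eq: "real (Suc n) * Im (h (Complex 0 (real (Suc n) + e)))
          = u (real (Suc n) + e) - e * Im (h (Complex 0 (real (Suc n) + e)))" for n
        by (simp add: u_def algebra_simps)
      have "u (real (Suc n)) - e * (C / real (Suc n)) \<le> real (Suc n) * Im (h (Complex 0 (real (Suc n) + e)))" for n
      proof -
        have "Im (h (Complex 0 (real (Suc n) + e))) \<le> C / (real (Suc n) + e)"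
          using Im_bound[of "Complex 0 (real (Suc n) + e)"] e by simp
        also have "\<dots> \<le> C / real (Suc n)" using e C by (intro divide_left_mono) auto
        finally show ?thesis
          unfolding eq using e u_mono[of "real (Suc n)" "real (Suc n) + e"]
          by (intro diff_mono mult_left_mono) auto
      qed
      then show "\<forall>\<^sub>F n in sequentially. u (Suc n) - e * (C / Suc n) \<le> real (Suc n) * Im (h (Complex 0 (real (Suc n) + e)))"
        by simp
      have "real (Suc n) * Im (h (Complex 0 (real (Suc n) + e))) \<le> r" for n
      proof -
        obtain k :: nat where k: "real (Suc n) + e \<le> real k" using real_arch_simple by blast
        have "u (real (Suc n) + e) \<le> u (Suc k)" using e k by (intro u_mono) auto
        also have "\<dots> \<le> r" by (rule r_ge)
        finally show ?thesis
          unfolding eq using e nonneg[of "Complex 0 (real (Suc n) + e)"]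
          by (smt (verit) mult_nonneg_nonneg Im_complex_of_real complex.sel(2) of_nat_0_le_iff)
      qed
      then show "\<forall>\<^sub>F n in sequentially. real (Suc n) * Im (h (Complex 0 (real (Suc n) + e))) \<le> r"
        by simp
    qed simp
    have monof: "mono (\<lambda>n. ?f n x)" for x
    proof (rule monoI)
      fix m n :: nat assume "m \<le> n"
      then have "\<bar>x / real (Suc n)\<bar> \<le> \<bar>x / real (Suc m)\<bar>"
        by (simp add: abs_divide divide_left_mono)
      then have "(x / real (Suc n))\<^sup>2 \<le> (x / real (Suc m))\<^sup>2" by (simp only: abs_le_square_iff)
      then show "?f m x \<le> ?f n x"
        unfolding k using d_nonneg[OF e] by (intro mult_left_mono frac_le) (auto simp: add_nonneg_pos)
    qed
    have limf: "(\<lambda>n. ?f n x) \<longlonglongrightarrow> d e x" for x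
    proof -
      have "(\<lambda>n. d e x * (1 / ((x / real (Suc n))\<^sup>2 + 1))) \<longlonglongrightarrow> d e x * (1 / (0\<^sup>2 + 1))"
        by (intro tendsto_intros LIMSEQ_Suc lim_const_over_n) auto
      then show ?thesis unfolding k by simp
    qed
    have ilim: "(\<lambda>n. integral\<^sup>L lborel (?f n)) \<longlonglongrightarrow> pi * r"
      unfolding val by (intro tendsto_intros lim)
    show ?thesis
      using integrable_monotone_convergence[OF int _ _ ilim, of "d e"]
        integral_monotone_convergence[OF int _ _ ilim, of "d e"] monof limf d_meas[OF e] by simp
  qed

  have "\<exists>\<rho>. finite_borel_measure \<rho> \<and> (\<forall>z. 0 < Im z \<longrightarrow> Im (h z) = Im (stieltjes \<rho> z))"
  proof (cases "r = 0")
    case True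
    have "Im (h z) = 0" if z: "0 < Im z" for z
    proof -
      define e where "e = Im z / 2"
      have e: "0 < e" using z by (simp add: e_def)
      have "AE x in lborel. d e x = 0"
        using integral_nonneg_eq_0_iff_AE[of lborel "d e"] mass[OF e] True d_nonneg[OF e] by simp
      then have "(LBINT x. d e x * poisson_kernel (z - \<i> * of_real e) x) = 0"
        by (intro integral_eq_zero_AE) (auto elim!: eventually_mono)
      then show ?thesis
        using dP(2)[of e "z - \<i> * of_real e"] e z by (simp add: e_def)
    qed
    moreover have "finite_borel_measure (null_measure borel)"
      by (rule finite_borel_measureI) (auto intro!: finite_measureI)
    ultimately show ?thesis
      by (intro exI[of _ "null_measure borel"]) (auto simp: stieltjes_def)
  next
    case False
    then have r: "0 < r" using r0 by simp
    define e where "e n = 1 / real (Suc n)" for n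
    have e: "0 < e n" "e n \<le> 1" for n by (auto simp: e_def)
    define \<mu> where "\<mu> n = density lborel (\<lambda>x. ennreal (d (e n) x / (pi * r)))" for n
    have fin: "finite_borel_measure (\<mu> n)" and one: "measure (\<mu> n) UNIV = 1" for n
      using finite_borel_measure_density[of lborel "\<lambda>x. d (e n) x / (pi * r)"] r
        d_nonneg[OF e(1)] d_meas[OF e(1)] mass[OF e(1)] by (auto simp: \<mu>_def)
    have P_int: "integral\<^sup>L (\<mu> n) (poisson_kernel z) = Im (h (z + \<i> * of_real (e n))) / r" if z: "0 < Im z" for n z
    proof -
      have "integral\<^sup>L (\<mu> n) (poisson_kernel z) = (LBINT x. d (e n) x / (pi * r) * poisson_kernel z x)"
        unfolding \<mu>_def using r d_nonneg[OF e(1)] d_meas[OF e(1)]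
        by (intro integral_poisson_kernel_density) auto
      also have "\<dots> = (LBINT x. d (e n) x * poisson_kernel z x) / (pi * r)"
        by simp
      finally show ?thesis using dP(2)[OF _ e(1) z, of n] r by simp
    qed
    have dist: "real_distribution (\<mu> n)" for n
    proof -
      interpret finite_borel_measure "\<mu> n" by (rule fin)
      have "emeasure (\<mu> n) (space (\<mu> n)) = 1"
        using one[of n] emeasure_eq_measure[of UNIV] by (simp add: borel_UNIV)
      then have "prob_space (\<mu> n)" by (rule prob_spaceI)
      then show ?thesis
        by (simp add: real_distribution_def real_distribution_axioms_def M_is_borel)
    qed
    have tight: "tight \<mu>"
      unfolding tight_def
    proof (intro conjI allI impI dist)
      fix \<epsilon> :: real assume \<epsilon>: "0 < \<epsilon>"
      have "(\<lambda>n. C / real (Suc n)) \<longlonglongrightarrow> 0" by real_asymp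
      from tendsto_diff[OF \<open>(\<lambda>n. u (Suc n)) \<longlonglongrightarrow> r\<close> this]
      have "(\<lambda>n. u (Suc n) - C / Suc n) \<longlonglongrightarrow> r" by simp
      moreover have "r * (1 - \<epsilon> / 2) < r" using \<epsilon> r by simp
      ultimately have "\<forall>\<^sub>F n in sequentially. r * (1 - \<epsilon> / 2) < u (Suc n) - C / Suc n"
        by (rule order_tendstoD)
      then obtain N where N: "r * (1 - \<epsilon> / 2) < u (Suc N) - C / Suc N"
        by (auto simp: eventually_sequentially)
      define y where "y = real (Suc N)"
      have y: "0 < y" by (simp add: y_def)
      have "1 - \<epsilon> < measure (\<mu> n) {- y<..y}" for n
      proof -
        interpret finite_borel_measure "\<mu> n" by (rule fin)
        have "measure (\<mu> n) {x. y \<le> \<bar>x\<bar>} \<le> 2 * (measure (\<mu> n) UNIV - y * Im (stieltjes (\<mu> n) (Complex 0 y)))"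
          using y by (intro tail_le_poisson_deficit) auto
        also have "\<dots> = 2 * (1 - y * (Im (h (Complex 0 (y + e n))) / r))"
        proof -
          have "Complex 0 y + \<i> * of_real (e n) = Complex 0 (y + e n)" by (simp add: complex_eq_iff)
          then show ?thesis using y P_int[of "Complex 0 y" n] by (simp add: one Im_stieltjes)
        qed
        also have "\<dots> < \<epsilon>"
        proof -
          let ?I = "Im (h (Complex 0 (y + e n)))"
          have "?I \<le> C / (y + e n)" using Im_bound[of "Complex 0 (y + e n)"] y e(1)[of n] by simp
          also have "\<dots> \<le> C / y" using y e(1)[of n] C by (intro divide_left_mono) auto
          finally have "e n * ?I \<le> 1 * (C / y)"
            using e[of n] nonneg[of "Complex 0 (y + e n)"] y by (intro mult_mono) auto
          moreover have "u y \<le> u (y + e n)" using y e(1)[of n] by (intro u_mono) auto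
          ultimately have "u y - C / y \<le> y * ?I" by (simp add: u_def algebra_simps)
          then have "r * (1 - \<epsilon> / 2) < y * ?I" using N by (simp add: y_def)
          then show ?thesis using r by (simp add: field_simps)
        qed
        finally have tail: "measure (\<mu> n) {x. y \<le> \<bar>x\<bar>} < \<epsilon>" .
        have "1 \<le> measure (\<mu> n) ({- y<..y} \<union> {x. y \<le> \<bar>x\<bar>})"
          unfolding one[of n, symmetric] by (intro finite_measure_mono) (auto simp: M_is_borel)
        also have "\<dots> \<le> measure (\<mu> n) {- y<..y} + measure (\<mu> n) {x. y \<le> \<bar>x\<bar>}"
          by (intro measure_Un_le) (auto simp: M_is_borel)
        finally show ?thesis using tail by linarith
      qed
      then show "\<exists>a b. a < b \<and> (\<forall>n. 1 - \<epsilon> < measure (\<mu> n) {a<..b})"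
        using y by (intro exI[of _ "- y"] exI[of _ y]) auto
    qed
    have "strict_mono (id :: nat \<Rightarrow> nat)" by (simp add: strict_mono_def)
    from tight_imp_convergent_subsubsequence[OF tight this]
    obtain s M where s: "strict_mono s" and M: "real_distribution M" and conv: "weak_conv_m (\<mu> \<circ> s) M"
      by auto
    interpret M: real_distribution M by (rule M)
    define \<rho> where "\<rho> = density M (\<lambda>x. ennreal r)"
    have \<rho>: "finite_borel_measure \<rho>"
      unfolding \<rho>_def using r by (intro finite_borel_measure_density(1)) auto
    have "Im (h z) = Im (stieltjes \<rho> z)" if z: "0 < Im z" for z
    proof -
      have "(\<lambda>n. integral\<^sup>L ((\<mu> \<circ> s) n) (poisson_kernel z)) \<longlonglongrightarrow> integral\<^sup>L M (poisson_kernel z)"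
      proof (rule weak_conv_imp_integral_bdd_continuous_conv[OF _ M conv])
        show "isCont (poisson_kernel z) x" for x
          using continuous_on_poisson_kernel[OF z, of UNIV] by (simp add: continuous_on_eq_continuous_at)
        show "norm (poisson_kernel z x) \<le> 1 / Im z" for x
          using poisson_kernel_le[OF z] poisson_kernel_nonneg[OF z] by simp
      qed (simp add: dist)
      then have "(\<lambda>n. Im (h (z + \<i> * of_real (e (s n)))) / r) \<longlonglongrightarrow> integral\<^sup>L M (poisson_kernel z)"
        by (simp add: P_int[OF z])
      moreover have "(\<lambda>n. Im (h (z + \<i> * of_real (e (s n)))) / r) \<longlonglongrightarrow> Im (h z) / r"
      proof (intro tendsto_intros tendsto_vertical_shift[OF hol z])
        have "e \<longlonglongrightarrow> 0" unfolding e_def by real_asymp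
        from LIMSEQ_subseq_LIMSEQ[OF this s] show "(\<lambda>n. e (s n)) \<longlonglongrightarrow> 0" by (simp add: o_def)
      qed (use r e in \<open>auto intro: less_imp_le\<close>)
      ultimately have "Im (h z) / r = integral\<^sup>L M (poisson_kernel z)"
        using LIMSEQ_unique by blast
      moreover have "integral\<^sup>L \<rho> (poisson_kernel z) = r * integral\<^sup>L M (poisson_kernel z)"
        unfolding \<rho>_def using r by (subst integral_poisson_kernel_density) auto
      ultimately show ?thesis
        using r by (simp add: finite_borel_measure.Im_stieltjes[OF \<rho> z] field_simps)
    qed
    then show ?thesis using \<rho> by blast
  qed
  then obtain \<rho> where \<rho>: "finite_borel_measure \<rho>" and eq: "\<And>z. 0 < Im z \<Longrightarrow> Im (h z) = Im (stieltjes \<rho> z)"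
    by blast
  have "\<exists>c::real. \<forall>z\<in>upper_half_plane. h z - stieltjes \<rho> z = of_real c"
    using eq by (intro real_valued_holomorphic_constant holomorphic_intros hol
        finite_borel_measure.holomorphic_stieltjes[OF \<rho>]) auto
  then obtain c :: real where "\<forall>z\<in>upper_half_plane. h z - stieltjes \<rho> z = of_real c" by blast
  then have "\<forall>z\<in>upper_half_plane. h z = stieltjes \<rho> z + of_real c" by (simp add: diff_eq_eq add.commute)
  then show ?thesis using \<rho> by blast
qed

section \<open>Weak convergence from Stieltjes transforms\<close>

definition cutoff :: "real \<Rightarrow> real \<Rightarrow> real" where
  "cutoff K x = max 0 (min 1 (K + 1 - \<bar>x\<bar>))"

lemma cutoff_range: "0 \<le> cutoff K x" "cutoff K x \<le> 1"
  by (auto simp: cutoff_def)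

lemma cutoff_eq: "\<bar>x\<bar> \<le> K \<Longrightarrow> cutoff K x = 1" "K + 1 \<le> \<bar>x\<bar> \<Longrightarrow> cutoff K x = 0"
  by (auto simp: cutoff_def)

lemma continuous_on_cutoff [continuous_intros]:
  "continuous_on A f \<Longrightarrow> continuous_on A (\<lambda>x. cutoff K (f x))"
  unfolding cutoff_def by (intro continuous_intros)

lemma poisson_kernel_swap: "poisson_kernel (Complex x e) t = poisson_kernel (Complex t e) x"
  by (simp add: poisson_kernel_def power2_commute)

text \<open>The convolution of \<open>g\<close> with the Cauchy distribution of scale \<open>e\<close>.\<close>

definition poisson_average :: "(real \<Rightarrow> real) \<Rightarrow> real \<Rightarrow> real \<Rightarrow> real" where
  "poisson_average g e t = (LBINT x. g x * poisson_kernel (Complex x e) t) / pi"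

lemma poisson_tail:
  assumes "0 < \<eta>"
  shows "\<exists>K>0. (LBINT v. indicator {v. K \<le> \<bar>v\<bar>} v * poisson_kernel \<i> v) < \<eta>"
proof -
  let ?P = "poisson_kernel \<i>"
  have P: "integrable lborel ?P" by (rule integrable_poisson_kernel_lborel) simp
  have "(\<lambda>n. LBINT v. indicator {v. real (Suc n) \<le> \<bar>v\<bar>} v * ?P v) \<longlonglongrightarrow> (LBINT v::real. 0)"
  proof (rule integral_dominated_convergence[where w = ?P])
    have "(\<lambda>n. indicator {v. real (Suc n) \<le> \<bar>v\<bar>} v * ?P v) \<longlonglongrightarrow> 0" for v
    proof (rule tendsto_eventually)
      obtain k :: nat where k: "\<bar>v\<bar> \<le> real k" using real_arch_simple by blast
      have "indicator {v. real (Suc n) \<le> \<bar>v\<bar>} v * ?P v = 0" if "n \<ge> k" for n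
      proof -
        have "\<bar>v\<bar> < real (Suc n)" using k that by simp
        then show ?thesis by simp
      qed
      then show "\<forall>\<^sub>F n in sequentially. indicator {v. real (Suc n) \<le> \<bar>v\<bar>} v * ?P v = 0"
        by (auto simp: eventually_sequentially)
    qed
    then show "AE v in lborel. (\<lambda>n. indicator {v. real (Suc n) \<le> \<bar>v\<bar>} v * ?P v) \<longlonglongrightarrow> 0" by simp
    show "AE v in lborel. norm (indicator {v. real (Suc n) \<le> \<bar>v\<bar>} v * ?P v) \<le> ?P v" for n
      by (auto simp: indicator_def poisson_kernel_nonneg)
  qed (use P in auto)
  then have "(\<lambda>n. LBINT v. indicator {v. real (Suc n) \<le> \<bar>v\<bar>} v * ?P v) \<longlonglongrightarrow> 0" by simp
  then have "\<forall>\<^sub>F n in sequentially. (LBINT v. indicator {v. real (Suc n) \<le> \<bar>v\<bar>} v * ?P v) < \<eta>"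
    using assms by (rule order_tendstoD)
  then obtain n where "(LBINT v. indicator {v. real (Suc n) \<le> \<bar>v\<bar>} v * ?P v) < \<eta>"
    by (auto simp: eventually_sequentially)
  then show ?thesis by (intro exI[of _ "real (Suc n)"]) auto
qed

text \<open>With \<open>e\<close> moved from the kernel into the argument of \<open>g\<close>, uniform continuity of \<open>g\<close> makes the
averages close to \<open>g\<close> uniformly in \<open>t\<close>.\<close>

lemma poisson_average_substitution:
  assumes e: "0 < e"
  shows "poisson_average g e t = (LBINT v. g (t + e * v) * poisson_kernel \<i> v) / pi"
proof -
  have "(LBINT x. g x * poisson_kernel (Complex t e) x)
      = \<bar>e\<bar> *\<^sub>R (LBINT v. g (t + e * v) * poisson_kernel (Complex t e) (t + e * v))"
    using e by (intro lborel_integral_real_affine) simp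
  also have "\<dots> = (LBINT v. e * (g (t + e * v) * poisson_kernel (Complex t e) (t + e * v)))"
    using e by simp
  also have "\<dots> = (LBINT v. g (t + e * v) * poisson_kernel \<i> v)"
  proof (intro Bochner_Integration.integral_cong refl)
    fix v
    have "e * (e / ((e * v)\<^sup>2 + e\<^sup>2)) = (e\<^sup>2 * 1) / (e\<^sup>2 * (v\<^sup>2 + 1))"
      by (simp add: power2_eq_square algebra_simps)
    also have "\<dots> = 1 / (v\<^sup>2 + 1)" using e by simp
    finally have "e * poisson_kernel (Complex t e) (t + e * v) = poisson_kernel \<i> v"
      by (simp add: poisson_kernel_def)
    then show "e * (g (t + e * v) * poisson_kernel (Complex t e) (t + e * v)) = g (t + e * v) * poisson_kernel \<i> v"
      by (simp add: mult.left_commute)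
  qed
  finally show ?thesis by (simp add: poisson_average_def poisson_kernel_swap[of _ e t])
qed

lemma poisson_average_uniform_approx:
  fixes g :: "real \<Rightarrow> real"
  assumes uc: "uniformly_continuous_on UNIV g" and B: "\<And>x. \<bar>g x\<bar> \<le> B" and \<eta>: "0 < \<eta>"
  shows "\<exists>e>0. \<forall>t. \<bar>poisson_average g e t - g t\<bar> \<le> \<eta>"
proof -
  have B0: "0 \<le> B" using order_trans[OF abs_ge_zero B[of 0]] .
  have "0 < \<eta> / 2" using \<eta> by simp
  then obtain \<delta> where \<delta>: "0 < \<delta>" "\<And>x y. \<bar>x - y\<bar> < \<delta> \<Longrightarrow> \<bar>g x - g y\<bar> < \<eta> / 2"
    by (rule uniformly_continuous_onE[OF uc]) (auto simp: dist_real_def)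
  obtain K where K: "0 < K" "(LBINT v. indicator {v. K \<le> \<bar>v\<bar>} v * poisson_kernel \<i> v) < \<eta> / (2 * B + 1)"
    using poisson_tail[of "\<eta> / (2 * B + 1)"] \<eta> B0 by auto
  let ?P = "poisson_kernel \<i>" and ?T = "\<lambda>v. indicator {v. K \<le> \<bar>v\<bar>} v * poisson_kernel \<i> v"
  have P: "integrable lborel ?P" "integral\<^sup>L lborel ?P = pi" "0 \<le> ?P v" for v
    by (simp_all add: integrable_poisson_kernel_lborel integral_poisson_kernel_lborel poisson_kernel_nonneg)
  have T: "integrable lborel ?T"
    using integrable_mult_indicator[OF _ P(1), of "{v. K \<le> \<bar>v\<bar>}"] by simp
  have meas[measurable]: "g \<in> borel_measurable borel"
    using uc by (intro borel_measurable_continuous_onI uniformly_continuous_imp_continuous)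
  define e where "e = \<delta> / K"
  have e: "0 < e" using \<delta> K by (simp add: e_def)
  have "\<bar>poisson_average g e t - g t\<bar> \<le> \<eta>" for t
  proof -
    have int: "integrable lborel (\<lambda>v. g (t + e * v) * ?P v)"
    proof (rule Bochner_Integration.integrable_bound[where f = "\<lambda>v. B * ?P v"])
      show "AE v in lborel. norm (g (t + e * v) * ?P v) \<le> norm (B * ?P v)"
        using B B0 P(3) by (auto simp: abs_mult intro!: mult_right_mono)
    qed (use P in auto)
    have pt: "\<bar>g (t + e * v) * ?P v - g t * ?P v\<bar> \<le> \<eta> / 2 * ?P v + 2 * B * ?T v" for v
    proof (cases "K \<le> \<bar>v\<bar>")
      case True
      have "\<bar>g (t + e * v) - g t\<bar> \<le> 2 * B"
        using B[of "t + e * v"] B[of t] abs_triangle_ineq4[of "g (t + e * v)" "g t"] by linarith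
      then have "\<bar>g (t + e * v) - g t\<bar> * ?P v \<le> 2 * B * ?P v" by (intro mult_right_mono P)
      moreover have "0 \<le> \<eta> / 2 * ?P v" using \<eta> P(3)[of v] by simp
      moreover have "\<bar>g (t + e * v) * ?P v - g t * ?P v\<bar> = \<bar>g (t + e * v) - g t\<bar> * ?P v"
        using P(3)[of v] by (simp add: left_diff_distrib[symmetric] abs_mult)
      moreover have T: "?T v = ?P v" using True by simp
      ultimately show ?thesis unfolding T by linarith
    next
      case False
      then have "\<bar>e * v\<bar> < \<delta>" using e K by (simp add: abs_mult e_def field_simps)
      then have "\<bar>g (t + e * v) - g t\<bar> \<le> \<eta> / 2" using \<delta>(2)[of "t + e * v" t] by simp
      then have "\<bar>g (t + e * v) - g t\<bar> * ?P v \<le> \<eta> / 2 * ?P v" by (intro mult_right_mono P)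
      then show ?thesis
        using False P(3)[of v] by (simp add: left_diff_distrib[symmetric] abs_mult)
    qed
    have "\<bar>LBINT v. g (t + e * v) * ?P v - g t * ?P v\<bar> \<le> (LBINT v. \<eta> / 2 * ?P v + 2 * B * ?T v)"
      using int P T pt by (intro integral_abs_bound_integral) auto
    also have "\<dots> = \<eta> / 2 * pi + 2 * B * integral\<^sup>L lborel ?T" using P T by simp
    also have "\<dots> \<le> \<eta> / 2 * pi + \<eta>"
    proof -
      have "2 * B * integral\<^sup>L lborel ?T \<le> 2 * B * (\<eta> / (2 * B + 1))"
        using K B0 by (intro mult_left_mono) auto
      also have "\<dots> \<le> \<eta>" using B0 \<eta> by (simp add: field_simps)
      finally show ?thesis by simp
    qed
    also have "\<dots> \<le> \<eta> * pi"
    proof -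
      have "\<eta> * 2 \<le> \<eta> * pi" using pi_gt3 \<eta> by (intro mult_left_mono) auto
      then show ?thesis by (simp add: field_simps)
    qed
    finally have "\<bar>(LBINT v. g (t + e * v) * ?P v) - g t * pi\<bar> \<le> \<eta> * pi"
      using int P by simp
    moreover have "\<bar>poisson_average g e t - g t\<bar> = \<bar>(LBINT v. g (t + e * v) * ?P v) - g t * pi\<bar> / pi"
    proof -
      have "poisson_average g e t - g t = ((LBINT v. g (t + e * v) * ?P v) - g t * pi) / pi"
        unfolding poisson_average_substitution[OF e] by (simp add: diff_divide_distrib)
      then show ?thesis by (simp add: abs_divide)
    qed
    ultimately show ?thesis by (simp add: pos_divide_le_eq)
  qed
  then show ?thesis using e by blast
qed

context finite_borel_measure
begin

lemma continuous_on_Im_stieltjes: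
  "0 < e \<Longrightarrow> continuous_on A (\<lambda>x. Im (stieltjes M (Complex x e)))"
  by (intro continuous_intros continuous_on_compose2[OF holomorphic_on_imp_continuous_on[OF holomorphic_stieltjes]])
    (auto simp: upper_half_plane_def Complex_eq intro!: continuous_intros)

text \<open>The Poisson kernel is symmetric in its two real arguments, so by Fubini's theorem averaging \<open>g\<close>
amounts to integrating \<open>g\<close> against the imaginary part of the transform on the line of height \<open>e\<close>.\<close>

lemma
  fixes g :: "real \<Rightarrow> real"
  assumes g: "integrable lborel g" and meas[measurable]: "g \<in> borel_measurable borel" and e: "0 < e"
  shows integrable_poisson_average: "integrable M (poisson_average g e)"
    and integral_poisson_average:
      "integral\<^sup>L M (poisson_average g e) = (LBINT x. g x * Im (stieltjes M (Complex x e))) / pi"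
proof -
  interpret pair_sigma_finite lborel M
    by (intro pair_sigma_finite.intro sigma_finite_measure_axioms lborel.sigma_finite_measure_axioms)
  note M_is_borel[measurable_cong]
  let ?f = "\<lambda>(x, t). g x * poisson_kernel (Complex x e) t"
  have pos: "0 < Im (Complex x e)" for x using e by simp
  have meas_f: "?f \<in> borel_measurable (lborel \<Otimes>\<^sub>M M)"
    unfolding poisson_kernel_def by (simp add: split_beta') measurable
  have abs_eq: "(LINT t|M. norm (?f (x, t))) = \<bar>g x\<bar> * Im (stieltjes M (Complex x e))" for x
  proof -
    have "norm (?f (x, t)) = \<bar>g x\<bar> * poisson_kernel (Complex x e) t" for t
      using poisson_kernel_nonneg[OF pos] by (simp add: abs_mult)
    then show ?thesis by (simp add: Im_stieltjes[OF pos])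
  qed
  have int_f: "integrable (lborel \<Otimes>\<^sub>M M) ?f"
  proof (rule Fubini_integrable[OF meas_f])
    show "integrable lborel (\<lambda>x. LINT t|M. norm (?f (x, t)))"
      unfolding abs_eq
    proof (rule Bochner_Integration.integrable_bound[where f = "\<lambda>x. measure M UNIV / e * g x"])
      show "(\<lambda>x. \<bar>g x\<bar> * Im (stieltjes M (Complex x e))) \<in> borel_measurable lborel"
        using borel_measurable_continuous_onI[OF continuous_on_Im_stieltjes[OF e]] by measurable
      show "AE x in lborel. norm (\<bar>g x\<bar> * Im (stieltjes M (Complex x e))) \<le> norm (measure M UNIV / e * g x)"
      proof (intro AE_I2)
        fix x
        have "\<bar>Im (stieltjes M (Complex x e))\<bar> \<le> measure M UNIV / e"
          using norm_stieltjes_le[OF e, of "Complex x e"] abs_Im_le_cmod[of "stieltjes M (Complex x e)"] by simp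
        then have "\<bar>g x\<bar> * \<bar>Im (stieltjes M (Complex x e))\<bar> \<le> \<bar>g x\<bar> * (measure M UNIV / e)"
          by (intro mult_left_mono) auto
        then show "norm (\<bar>g x\<bar> * Im (stieltjes M (Complex x e))) \<le> norm (measure M UNIV / e * g x)"
          using e by (simp add: abs_mult mult.commute)
      qed
    qed (use g in simp)
    show "AE x in lborel. integrable M (\<lambda>t. ?f (x, t))"
      using integrable_poisson_kernel[OF pos] by simp
  qed
  have avg: "poisson_average g e = (\<lambda>t. (LBINT x. ?f (x, t)) / pi)"
    by (simp add: poisson_average_def fun_eq_iff)
  show "integrable M (poisson_average g e)"
    unfolding avg using integrable_snd[of "\<lambda>x t. ?f (x, t)"] int_f by simp
  have "(LINT t|M. (LBINT x. ?f (x, t))) = (LBINT x. (LINT t|M. ?f (x, t)))"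
    using Fubini_integral[of "\<lambda>x t. ?f (x, t)"] int_f by simp
  then show "integral\<^sup>L M (poisson_average g e) = (LBINT x. g x * Im (stieltjes M (Complex x e))) / pi"
    unfolding avg by (simp add: Im_stieltjes[OF pos])
qed

end

lemma uniformly_continuous_compact_support:
  fixes g :: "real \<Rightarrow> real"
  assumes cont: "continuous_on UNIV g" and supp: "\<And>x. K \<le> \<bar>x\<bar> \<Longrightarrow> g x = 0"
  shows "uniformly_continuous_on UNIV g"
  unfolding uniformly_continuous_on_def
proof (intro allI impI)
  fix \<epsilon> :: real assume \<epsilon>: "0 < \<epsilon>"
  have "uniformly_continuous_on {- (K + 1)..K + 1} g"
    by (intro compact_uniformly_continuous continuous_on_subset[OF cont]) auto
  then obtain \<delta> where \<delta>: "0 < \<delta>"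
    "\<And>x y. x \<in> {- (K + 1)..K + 1} \<Longrightarrow> y \<in> {- (K + 1)..K + 1} \<Longrightarrow> dist y x < \<delta> \<Longrightarrow> dist (g y) (g x) < \<epsilon>"
    using \<epsilon> unfolding uniformly_continuous_on_def by meson
  have "dist (g y) (g x) < \<epsilon>" if d: "dist y x < min \<delta> 1" for x y
  proof (cases "\<bar>x\<bar> \<le> K + 1 \<and> \<bar>y\<bar> \<le> K + 1")
    case True
    then show ?thesis using d by (intro \<delta>(2)) auto
  next
    case False
    then have "K \<le> \<bar>x\<bar>" "K \<le> \<bar>y\<bar>" using d by (auto simp: dist_real_def)
    then show ?thesis using supp \<epsilon> by simp
  qed
  then show "\<exists>d>0. \<forall>x\<in>UNIV. \<forall>x'\<in>UNIV. dist x' x < d \<longrightarrow> dist (g x') (g x) < \<epsilon>"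
    using \<delta>(1) by (intro exI[of _ "min \<delta> 1"]) auto
qed

lemma bounded_compact_support:
  fixes g :: "real \<Rightarrow> real"
  assumes cont: "continuous_on UNIV g" and supp: "\<And>x. K \<le> \<bar>x\<bar> \<Longrightarrow> g x = 0"
  obtains B where "\<And>x. \<bar>g x\<bar> \<le> B"
proof -
  have "compact (g ` {- K..K})" by (intro compact_continuous_image continuous_on_subset[OF cont]) auto
  then obtain B where B: "\<And>x. x \<in> {- K..K} \<Longrightarrow> \<bar>g x\<bar> \<le> B"
    by (metis bounded_iff compact_imp_bounded imageI real_norm_def)
  have "\<bar>g x\<bar> \<le> max B 0" for x
  proof (cases "K \<le> \<bar>x\<bar>")
    case False
    then have "x \<in> {- K..K}" by auto
    from B[OF this] show ?thesis by simp
  qed (simp add: supp)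
  then show ?thesis using that by blast
qed

text \<open>Replacing \<open>g\<close> by a Poisson average changes all the integrals by a uniformly small amount. The
integrals of the average converge by dominated convergence, since only the imaginary parts of the
transforms on one horizontal line enter, and \<open>R / e\<close> bounds them there.\<close>

lemma vague_convergence:
  fixes \<rho> :: "nat \<Rightarrow> real measure" and g :: "real \<Rightarrow> real"
  assumes fin: "\<And>n. finite_borel_measure (\<rho> n)" "finite_borel_measure \<nu>"
    and mass: "\<And>n. measure (\<rho> n) UNIV \<le> R"
    and conv: "\<And>z. 0 < Im z \<Longrightarrow> (\<lambda>n. Im (stieltjes (\<rho> n) z)) \<longlonglongrightarrow> Im (stieltjes \<nu> z)"
    and cont: "continuous_on UNIV g" and supp: "\<And>x. K \<le> \<bar>x\<bar> \<Longrightarrow> g x = 0"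
  shows "(\<lambda>n. integral\<^sup>L (\<rho> n) g) \<longlonglongrightarrow> integral\<^sup>L \<nu> g"
proof -
  obtain B where B: "\<And>x. \<bar>g x\<bar> \<le> B" using bounded_compact_support[OF cont supp] by blast
  have uc: "uniformly_continuous_on UNIV g" by (rule uniformly_continuous_compact_support[OF cont supp])
  have meas[measurable]: "g \<in> borel_measurable borel" by (rule borel_measurable_continuous_onI[OF cont])
  have g_int: "integrable lborel g"
  proof -
    have "set_integrable lborel {- \<bar>K\<bar>..\<bar>K\<bar>} g"
      by (intro borel_integrable_atLeastAtMost' continuous_on_subset[OF cont]) auto
    moreover have "indicator {- \<bar>K\<bar>..\<bar>K\<bar>} x *\<^sub>R g x = g x" for x
    proof (cases "K \<le> \<bar>x\<bar>")
      case False
      then have "x \<in> {- \<bar>K\<bar>..\<bar>K\<bar>}" by auto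
      then show ?thesis by simp
    qed (simp add: supp)
    ultimately show ?thesis by (simp only: set_integrable_def)
  qed
  have R0: "0 \<le> R" using order_trans[OF measure_nonneg mass[of 0]] .
  define R' where "R' = R + measure \<nu> UNIV + 1"
  have R': "0 < R'" "measure \<nu> UNIV \<le> R'" "measure (\<rho> n) UNIV \<le> R'" for n
    using R0 mass[of n] measure_nonneg[of \<nu> UNIV] unfolding R'_def by linarith+
  show ?thesis
  proof (rule LIMSEQ_I)
    fix \<epsilon> :: real assume \<epsilon>: "0 < \<epsilon>"
    define \<eta> where "\<eta> = \<epsilon> / (4 * R')"
    have \<eta>: "0 < \<eta>" using \<epsilon> R' by (simp add: \<eta>_def)
    obtain e where e: "0 < e" and avg: "\<And>t. \<bar>poisson_average g e t - g t\<bar> \<le> \<eta>"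
      using poisson_average_uniform_approx[OF uc B \<eta>] by blast
    have close: "\<bar>integral\<^sup>L M (poisson_average g e) - integral\<^sup>L M g\<bar> \<le> \<epsilon> / 4"
      if M: "finite_borel_measure M" "measure M UNIV \<le> R'" for M
    proof -
      interpret finite_borel_measure M by (rule M)
      have int: "integrable M g" by (rule integrable_bounded[of _ B]) (use B in auto)
      note avg_int = integrable_poisson_average[OF g_int meas e]
      have "\<bar>LINT t|M. poisson_average g e t - g t\<bar> \<le> (LINT t|M. \<eta>)"
        using int avg_int avg by (intro integral_abs_bound_integral) auto
      also have "\<dots> = measure M UNIV * \<eta>" by (simp add: borel_UNIV)
      also have "\<dots> \<le> R' * \<eta>" using M(2) \<eta> by (intro mult_right_mono) auto
      also have "\<dots> = \<epsilon> / 4" using R' by (simp add: \<eta>_def)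
      finally show ?thesis using int avg_int by simp
    qed
    have "(\<lambda>n. LBINT x. g x * Im (stieltjes (\<rho> n) (Complex x e))) \<longlonglongrightarrow> (LBINT x. g x * Im (stieltjes \<nu> (Complex x e)))"
    proof (rule integral_dominated_convergence[where w = "\<lambda>x. \<bar>g x\<bar> * (R / e)"])
      have m: "(\<lambda>x. Im (stieltjes M (Complex x e))) \<in> borel_measurable borel" if "finite_borel_measure M" for M
        by (rule borel_measurable_continuous_onI[OF finite_borel_measure.continuous_on_Im_stieltjes[OF that e]])
      show "(\<lambda>x. g x * Im (stieltjes \<nu> (Complex x e))) \<in> borel_measurable lborel"
        using m[OF fin(2)] by measurable
      show "(\<lambda>x. g x * Im (stieltjes (\<rho> n) (Complex x e))) \<in> borel_measurable lborel" for n
        using m[OF fin(1)] by measurable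
      show "integrable lborel (\<lambda>x. \<bar>g x\<bar> * (R / e))" using g_int by simp
      show "AE x in lborel. (\<lambda>n. g x * Im (stieltjes (\<rho> n) (Complex x e))) \<longlonglongrightarrow> g x * Im (stieltjes \<nu> (Complex x e))"
        using e by (intro AE_I2 tendsto_intros conv) simp
      show "AE x in lborel. norm (g x * Im (stieltjes (\<rho> n) (Complex x e))) \<le> \<bar>g x\<bar> * (R / e)" for n
      proof (intro AE_I2)
        fix x
        have "\<bar>Im (stieltjes (\<rho> n) (Complex x e))\<bar> \<le> measure (\<rho> n) UNIV / e"
          using finite_borel_measure.norm_stieltjes_le[OF fin(1) e, of "Complex x e" n]
            abs_Im_le_cmod[of "stieltjes (\<rho> n) (Complex x e)"] by simp
        also have "\<dots> \<le> R / e" using e mass[of n] by (simp add: divide_right_mono)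
        finally show "norm (g x * Im (stieltjes (\<rho> n) (Complex x e))) \<le> \<bar>g x\<bar> * (R / e)"
          unfolding real_norm_def abs_mult by (rule mult_left_mono) simp
      qed
    qed
    then have "(\<lambda>n. integral\<^sup>L (\<rho> n) (poisson_average g e)) \<longlonglongrightarrow> integral\<^sup>L \<nu> (poisson_average g e)"
      unfolding finite_borel_measure.integral_poisson_average[OF fin(1) g_int meas e]
        finite_borel_measure.integral_poisson_average[OF fin(2) g_int meas e]
      by (intro tendsto_intros) auto
    then obtain N where N: "\<And>n. n \<ge> N \<Longrightarrow>
        \<bar>integral\<^sup>L (\<rho> n) (poisson_average g e) - integral\<^sup>L \<nu> (poisson_average g e)\<bar> < \<epsilon> / 4"
      using LIMSEQ_D[of _ _ "\<epsilon> / 4"] \<epsilon> by fastforce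
    have "norm (integral\<^sup>L (\<rho> n) g - integral\<^sup>L \<nu> g) < \<epsilon>" if "n \<ge> N" for n
      using N[OF that] close[OF fin(1) R'(3), of n] close[OF fin(2) R'(2)] \<epsilon> unfolding real_norm_def by linarith
    then show "\<exists>N. \<forall>n\<ge>N. norm (integral\<^sup>L (\<rho> n) g - integral\<^sup>L \<nu> g) < \<epsilon>" by blast
  qed
qed

lemma (in finite_borel_measure) cutoff_integral_tendsto:
  fixes g :: "real \<Rightarrow> real"
  assumes meas: "g \<in> borel_measurable borel" and B: "\<And>x. \<bar>g x\<bar> \<le> B"
  shows "(\<lambda>n. LINT x|M. g x * cutoff (real n) x) \<longlonglongrightarrow> integral\<^sup>L M g"
proof (rule integral_dominated_convergence[where w = "\<lambda>_. B"])
  have cm: "cutoff (real n) \<in> borel_measurable borel" for n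
    by (intro borel_measurable_continuous_onI continuous_intros)
  show "g \<in> borel_measurable M" by (rule borel_measurable_M[OF meas])
  show "(\<lambda>x. g x * cutoff (real n) x) \<in> borel_measurable M" for n
    by (intro borel_measurable_M borel_measurable_times meas cm)
  have "(\<lambda>n. g x * cutoff (real n) x) \<longlonglongrightarrow> g x" for x
  proof (rule tendsto_eventually)
    obtain k :: nat where "\<bar>x\<bar> \<le> real k" using real_arch_simple by blast
    then have "g x * cutoff (real n) x = g x" if "n \<ge> k" for n using that by (simp add: cutoff_eq)
    then show "\<forall>\<^sub>F n in sequentially. g x * cutoff (real n) x = g x" by (auto simp: eventually_sequentially)
  qed
  then show "AE x in M. (\<lambda>n. g x * cutoff (real n) x) \<longlonglongrightarrow> g x" by simp
  show "AE x in M. norm (g x * cutoff (real n) x) \<le> B" for n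
  proof (intro AE_I2)
    fix x
    have "\<bar>g x\<bar> * cutoff (real n) x \<le> B * 1"
      using B[of x] cutoff_range[of n x] by (intro mult_mono) auto
    then show "norm (g x * cutoff (real n) x) \<le> B" using cutoff_range[of n x] by (simp add: abs_mult)
  qed
qed simp

text \<open>Tightness makes the error of a cutoff uniform along the sequence, which reduces the claim to vague
convergence.\<close>

lemma weak_convergence_of_stieltjes:
  fixes \<rho> :: "nat \<Rightarrow> real measure" and g :: "real \<Rightarrow> real"
  assumes fin: "\<And>n. finite_borel_measure (\<rho> n)" "finite_borel_measure \<nu>"
    and mass: "\<And>n. measure (\<rho> n) UNIV \<le> R"
    and tight: "\<And>\<eta>. 0 < \<eta> \<Longrightarrow> \<exists>K. \<forall>n. measure (\<rho> n) {x. K \<le> \<bar>x\<bar>} \<le> \<eta>"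
    and conv: "\<And>z. 0 < Im z \<Longrightarrow> (\<lambda>n. Im (stieltjes (\<rho> n) z)) \<longlonglongrightarrow> Im (stieltjes \<nu> z)"
    and cont: "continuous_on UNIV g" and B: "\<And>x. \<bar>g x\<bar> \<le> B"
  shows "(\<lambda>n. integral\<^sup>L (\<rho> n) g) \<longlonglongrightarrow> integral\<^sup>L \<nu> g"
proof (rule LIMSEQ_I)
  fix \<epsilon> :: real assume \<epsilon>: "0 < \<epsilon>"
  have B0: "0 \<le> B" using order_trans[OF abs_ge_zero B[of 0]] .
  have meas: "g \<in> borel_measurable borel" by (rule borel_measurable_continuous_onI[OF cont])
  obtain K where K: "\<And>n. measure (\<rho> n) {x. K \<le> \<bar>x\<bar>} \<le> \<epsilon> / (4 * (B + 1))"
    using tight[of "\<epsilon> / (4 * (B + 1))"] \<epsilon> B0 by auto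
  obtain N0 where N0: "\<And>k. k \<ge> N0 \<Longrightarrow> \<bar>(LINT x|\<nu>. g x * cutoff (real k) x) - integral\<^sup>L \<nu> g\<bar> < \<epsilon> / 4"
    using LIMSEQ_D[OF finite_borel_measure.cutoff_integral_tendsto[OF fin(2) meas B], of "\<epsilon> / 4"] \<epsilon> by auto
  obtain k0 :: nat where k0: "K \<le> real k0" using real_arch_simple by blast
  define k where "k = max N0 k0"
  let ?h = "\<lambda>x. g x * cutoff (real k) x"
  have "(\<lambda>n. integral\<^sup>L (\<rho> n) ?h) \<longlonglongrightarrow> integral\<^sup>L \<nu> ?h"
    by (rule vague_convergence[OF fin mass conv, where K = "real k + 1"])
       (auto intro!: continuous_intros cont simp: cutoff_eq)
  then obtain N where N: "\<And>n. n \<ge> N \<Longrightarrow> \<bar>integral\<^sup>L (\<rho> n) ?h - integral\<^sup>L \<nu> ?h\<bar> < \<epsilon> / 4"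
    using LIMSEQ_D[of _ _ "\<epsilon> / 4"] \<epsilon> by fastforce
  have cut: "\<bar>integral\<^sup>L (\<rho> n) g - integral\<^sup>L (\<rho> n) ?h\<bar> \<le> \<epsilon> / 4" for n
  proof -
    interpret finite_borel_measure "\<rho> n" by (rule fin)
    let ?A = "{x. K \<le> \<bar>x\<bar>}"
    have A: "?A \<in> sets (\<rho> n)" by (rule sets_M) simp
    have g_int: "integrable (\<rho> n) g" by (rule integrable_bounded[of _ B]) (use meas B in auto)
    have hb: "\<bar>?h x\<bar> \<le> B" for x
      using mult_mono[OF B[of x] cutoff_range(2)[of k x] B0] cutoff_range[of k x] by (simp add: abs_mult)
    have h_int: "integrable (\<rho> n) ?h"
      by (rule integrable_bounded[of _ B]) (use hb in \<open>auto intro!: borel_measurable_continuous_onI continuous_intros cont\<close>)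
    have pt: "\<bar>g x - ?h x\<bar> \<le> B * indicator ?A x" for x
    proof (cases "K \<le> \<bar>x\<bar>")
      case True
      have "g x - ?h x = g x * (1 - cutoff k x)" by (simp add: algebra_simps)
      then have "\<bar>g x - ?h x\<bar> = \<bar>g x\<bar> * (1 - cutoff k x)"
        using cutoff_range[of k x] by (simp add: abs_mult)
      also have "\<dots> \<le> B * 1" using B[of x] cutoff_range[of k x] B0 by (intro mult_mono) auto
      finally show ?thesis using True by simp
    next
      case False
      then have "\<bar>x\<bar> \<le> real k" using k0 by (simp add: k_def)
      then show ?thesis using False by (simp add: cutoff_eq)
    qed
    have "\<bar>LINT x|\<rho> n. g x - ?h x\<bar> \<le> (LINT x|\<rho> n. B * indicator ?A x)"
      using g_int h_int pt A by (intro integral_abs_bound_integral) (auto simp: emeasure_eq_measure)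
    also have "\<dots> = B * measure (\<rho> n) ?A" using A by (simp add: borel_UNIV)
    also have "\<dots> \<le> (B + 1) * (\<epsilon> / (4 * (B + 1)))" using K[of n] B0 by (intro mult_mono) auto
    also have "\<dots> = \<epsilon> / 4"
    proof -
      have "c * (\<epsilon> / (4 * c)) = \<epsilon> / 4" if "0 < c" for c using that by simp
      from this[of "B + 1"] show ?thesis using B0 by linarith
    qed
    finally show ?thesis using g_int h_int by simp
  qed
  have "norm (integral\<^sup>L (\<rho> n) g - integral\<^sup>L \<nu> g) < \<epsilon>" if "n \<ge> N" for n
    using N[OF that] cut[of n] N0[of k] \<epsilon> unfolding real_norm_def k_def by linarith
  then show "\<exists>N. \<forall>n\<ge>N. norm (integral\<^sup>L (\<rho> n) g - integral\<^sup>L \<nu> g) < \<epsilon>" by blast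
qed

text \<open>The constant sequence \<open>\<rho>\<close> converges vaguely to \<open>\<nu>\<close>, hence the two measures give
the same integrals to continuous functions of compact support, then by dominated convergence to
bounded continuous ones, and finally to the indicator functions of half-lines.\<close>

lemma stieltjes_inject:
  assumes fin: "finite_borel_measure \<rho>" "finite_borel_measure \<nu>"
    and eq: "\<And>z. 0 < Im z \<Longrightarrow> Im (stieltjes \<rho> z) = Im (stieltjes \<nu> z)"
  shows "\<rho> = \<nu>"
proof (rule cdf_unique'[OF fin], rule ext)
  fix a
  have int_eq: "integral\<^sup>L \<rho> g = integral\<^sup>L \<nu> g"
    if cont: "continuous_on UNIV g" and B: "\<And>x. \<bar>g x\<bar> \<le> B" for g :: "real \<Rightarrow> real" and B
  proof -
    have meas: "g \<in> borel_measurable borel" by (rule borel_measurable_continuous_onI[OF cont])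
    have "(LINT x|\<rho>. g x * cutoff (real n) x) = (LINT x|\<nu>. g x * cutoff (real n) x)" for n
    proof -
      have "(\<lambda>_::nat. LINT x|\<rho>. g x * cutoff (real n) x) \<longlonglongrightarrow> (LINT x|\<nu>. g x * cutoff (real n) x)"
        by (rule vague_convergence[OF fin, where K = "real n + 1"])
           (auto intro!: continuous_intros cont simp: cutoff_eq eq)
      then show ?thesis using LIMSEQ_unique tendsto_const by blast
    qed
    then show ?thesis
      using finite_borel_measure.cutoff_integral_tendsto[OF fin(1) meas B]
        finite_borel_measure.cutoff_integral_tendsto[OF fin(2) meas B] LIMSEQ_unique by simp
  qed
  define s where "s n x = max 0 (min 1 (1 - real n * (x - a)))" for n x
  have s_cont: "continuous_on UNIV (s n)" for n unfolding s_def by (intro continuous_intros)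
  have s_bound: "\<bar>s n x\<bar> \<le> 1" for n x by (auto simp: s_def)
  have lim: "(\<lambda>n. integral\<^sup>L M (s n)) \<longlonglongrightarrow> cdf M a" if "finite_borel_measure M" for M
  proof -
    interpret finite_borel_measure M by fact
    have "(\<lambda>n. integral\<^sup>L M (s n)) \<longlonglongrightarrow> integral\<^sup>L M (indicator {..a})"
    proof (rule integral_dominated_convergence[where w = "\<lambda>_. 1"])
      show "(indicator {..a} :: real \<Rightarrow> real) \<in> borel_measurable M" by (intro borel_measurable_M) simp
      show "s n \<in> borel_measurable M" for n
        by (intro borel_measurable_M borel_measurable_continuous_onI s_cont)
      have "(\<lambda>n. s n x) \<longlonglongrightarrow> indicator {..a} x" for x
      proof (rule tendsto_eventually)
        show "\<forall>\<^sub>F n in sequentially. s n x = indicator {..a} x"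
        proof (cases "x \<le> a")
          case True
          then have "s n x = 1" for n by (simp add: s_def mult_nonneg_nonpos)
          then show ?thesis using True by simp
        next
          case False
          then obtain k :: nat where k: "1 / (x - a) \<le> real k" using real_arch_simple by blast
          have "s n x = 0" if "n \<ge> k" for n
          proof -
            have "1 / (x - a) \<le> real n" using k that by linarith
            then have "1 \<le> real n * (x - a)" using False by (simp add: field_simps)
            then show ?thesis by (simp add: s_def)
          qed
          then show ?thesis using False by (auto simp: eventually_sequentially)
        qed
      qed
      then show "AE x in M. (\<lambda>n. s n x) \<longlonglongrightarrow> indicator {..a} x" by simp
    qed (use s_bound in auto)
    also have "integral\<^sup>L M (indicator {..a}) = cdf M a"
      by (simp add: cdf_def borel_UNIV)
    finally show ?thesis .
  qed
  show "cdf \<rho> a = cdf \<nu> a"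
    using lim[OF fin(1)] lim[OF fin(2)] int_eq[OF s_cont s_bound] LIMSEQ_unique by simp
qed

section \<open>Subordination\<close>

text \<open>The equation \<open>w = a + m - S(w)\<close> is solved by the contraction principle on \<open>Im w \<ge> k\<close>, where \<open>S\<close> has
Lipschitz constant below \<open>1\<close> and imaginary part at most \<open>k\<close>.\<close>

lemma (in finite_borel_measure) high_values_attained:
  assumes k: "0 < k" "measure M UNIV < k\<^sup>2" and a: "2 * k \<le> Im a"
  shows "\<exists>w. k \<le> Im w \<and> w - complex_of_real m + stieltjes M w = a"
proof -
  let ?X = "{w. k \<le> Im w}" and ?\<Psi> = "\<lambda>w. a + of_real m - stieltjes M w"
  have "\<exists>!w\<in>?X. ?\<Psi> w = w"
  proof (rule Banach_fix)
    show "Topological_Spaces.complete ?X" by (simp add: complete_eq_closed closed_halfspace_Im_ge)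
    show "?X \<noteq> {}" using k by (auto intro!: exI[of _ "\<i> * of_real k"])
    show "0 \<le> measure M UNIV / k\<^sup>2" by simp
    show "measure M UNIV / k\<^sup>2 < 1" using k by simp
    show "?\<Psi> ` ?X \<subseteq> ?X"
    proof (rule image_subsetI)
      fix w assume "w \<in> ?X"
      then have "Im (stieltjes M w) \<le> measure M UNIV / k"
        using norm_stieltjes_le[OF k(1), of w] abs_Im_le_cmod[of "stieltjes M w"] by simp
      also have "\<dots> \<le> k" using k by (simp add: divide_le_eq power2_eq_square)
      finally show "?\<Psi> w \<in> ?X" using a by simp
    qed
    show "dist (?\<Psi> w) (?\<Psi> v) \<le> measure M UNIV / k\<^sup>2 * dist w v" if "w \<in> ?X" "v \<in> ?X" for w v
      using dist_stieltjes_le[OF k(1), of w v] that by (simp add: dist_norm norm_minus_commute)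
  qed
  then obtain w where "k \<le> Im w" "a + of_real m - stieltjes M w = w" by auto
  then show ?thesis by (intro exI[of _ w]) (auto simp: algebra_simps)
qed

text \<open>The map \<open>\<phi>\<close> is \<open>f1\<^sup>-\<^sup>1 \<circ> f2\<close>. Injectivity of \<open>f1\<close> matters beyond its definition: for
points \<open>z\<close> high up, the equation \<open>f1(w) = f2(z)\<close> could have solutions near the real axis as well, and
only injectivity identifies \<open>\<phi>(z)\<close> with the high solution of \<open>high_values_attained\<close>. Hence
\<open>\<phi>(z) - z\<close> is bounded high up, \<open>Im \<phi>(x + iy) / y\<close> tends to \<open>1\<close>, and since this quotient
decreases in \<open>y\<close>, it is at least \<open>1\<close> everywhere. Then \<open>\<phi>(z) - z\<close> has nonnegative imaginary part,
\<open>y Im(\<phi>(iy) - iy)\<close> increases in \<open>y\<close>, and the asymptotics of the two transforms identify its limit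
as the difference of the masses.\<close>

lemma subordination:
  assumes fin: "finite_borel_measure \<rho>1" "finite_borel_measure \<rho>2"
    and rep1: "\<And>z. 0 < Im z \<Longrightarrow> f1 z = z - complex_of_real m1 + stieltjes \<rho>1 z"
    and rep2: "\<And>z. 0 < Im z \<Longrightarrow> f2 z = z - complex_of_real m2 + stieltjes \<rho>2 z"
    and inj: "inj_on f1 upper_half_plane"
    and range: "f2 ` upper_half_plane \<subseteq> f1 ` upper_half_plane"
  obtains \<phi> where "\<And>z. 0 < Im z \<Longrightarrow> Im z \<le> Im (\<phi> z)" "\<And>z. 0 < Im z \<Longrightarrow> f1 (\<phi> z) = f2 z"
    and "\<And>z. 0 < Im z \<Longrightarrow>
           cmod (\<phi> z - z) \<le> \<bar>m1 - m2\<bar> + (measure \<rho>1 UNIV + measure \<rho>2 UNIV) / Im z"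
    and "\<And>y. 0 < y \<Longrightarrow> y * (Im (\<phi> (Complex 0 y)) - y) \<le> measure \<rho>2 UNIV - measure \<rho>1 UNIV"
proof -
  interpret M1: finite_borel_measure \<rho>1 by (rule fin)
  interpret M2: finite_borel_measure \<rho>2 by (rule fin)
  let ?H = upper_half_plane and ?S1 = "stieltjes \<rho>1" and ?S2 = "stieltjes \<rho>2"
  let ?r1 = "measure \<rho>1 UNIV" and ?r2 = "measure \<rho>2 UNIV"
  have openH: "open ?H" unfolding upper_half_plane_def by (rule open_halfspace_Im_gt)
  have hol1: "f1 holomorphic_on ?H" and hol2: "f2 holomorphic_on ?H"
  proof -
    show "f1 holomorphic_on ?H"
      by (rule holomorphic_transform[of "\<lambda>z. z - of_real m1 + ?S1 z"],
          intro holomorphic_intros M1.holomorphic_stieltjes, simp add: upper_half_plane_def rep1)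
    show "f2 holomorphic_on ?H"
      by (rule holomorphic_transform[of "\<lambda>z. z - of_real m2 + ?S2 z"],
          intro holomorphic_intros M2.holomorphic_stieltjes, simp add: upper_half_plane_def rep2)
  qed
  obtain g where g: "g holomorphic_on f1 ` ?H" "\<And>z. z \<in> ?H \<Longrightarrow> g (f1 z) = z"
    using holomorphic_has_inverse[OF hol1 openH inj] by metis
  define \<phi> where "\<phi> = g \<circ> f2"
  have hol_\<phi>: "\<phi> holomorphic_on ?H"
    unfolding \<phi>_def by (rule holomorphic_on_compose_gen[OF hol2 g(1) range])
  have \<phi>: "0 < Im (\<phi> z)" "f1 (\<phi> z) = f2 z" if z: "0 < Im z" for z
  proof -
    obtain w where w: "w \<in> ?H" "f2 z = f1 w"
      using z range by (auto simp: upper_half_plane_def)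
    then have "\<phi> z = w" using g(2) by (simp add: \<phi>_def)
    then show "0 < Im (\<phi> z)" "f1 (\<phi> z) = f2 z" using w by (auto simp: upper_half_plane_def)
  qed
  have \<phi>_eq: "\<phi> z - z = of_real (m1 - m2) + ?S2 z - ?S1 (\<phi> z)" if "0 < Im z" for z
    using \<phi>(2)[OF that] rep1[OF \<phi>(1)[OF that]] rep2[OF that] by (simp add: algebra_simps)

  \<comment> \<open>high up, the preimage under \<open>f1\<close> is the one found by the contraction principle\<close>
  have half: "Im z / 2 \<le> Im (\<phi> z)" if z: "0 < Im z" "?r1 < (Im z / 2)\<^sup>2" for z
  proof -
    have Im_f2: "Im z \<le> Im (f2 z)" using M2.Im_stieltjes_nonneg[OF z(1)] rep2[OF z(1)] by simp
    obtain w where w: "Im z / 2 \<le> Im w" "w - of_real m1 + ?S1 w = f2 z"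
      using M1.high_values_attained[of "Im z / 2" "f2 z" m1] z Im_f2 by auto
    have "f1 w = f1 (\<phi> z)" using w z rep1[of w] \<phi>(2)[OF z(1)] by simp
    then have "w = \<phi> z"
      using inj_onD[OF inj] w z \<phi>(1)[OF z(1)] by (auto simp: upper_half_plane_def)
    then show ?thesis using w by simp
  qed
  have disp: "cmod (\<phi> z - z) \<le> \<bar>m1 - m2\<bar> + ?r2 / Im z + ?r1 / k"
    if z: "0 < Im z" and k: "0 < k" "k \<le> Im (\<phi> z)" for z k
  proof -
    have "cmod (\<phi> z - z) \<le> cmod (of_real (m1 - m2)) + cmod (?S2 z) + cmod (?S1 (\<phi> z))"
      unfolding \<phi>_eq[OF z]
      using norm_triangle_ineq4[of "of_real (m1 - m2) + ?S2 z" "?S1 (\<phi> z)"]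
        norm_triangle_ineq[of "of_real (m1 - m2)" "?S2 z"] by linarith
    then show ?thesis
      using M2.norm_stieltjes_le[OF z order.refl] M1.norm_stieltjes_le[OF k]
      unfolding norm_of_real by linarith
  qed
  have Im_le: "Im z \<le> Im (\<phi> z)" if z: "0 < Im z" for z
  proof -
    define D where "D = \<bar>m1 - m2\<bar> + ?r2 + 2 * ?r1"
    define Y where "Y n = real n + Im z + 2 + 2 * ?r1" for n
    have Y: "0 < Im z" "Im z \<le> Y n" "1 \<le> Y n" for n using z by (auto simp: Y_def)
    have "Im z - Im z * D / Y n \<le> Im (\<phi> z)" for n
    proof -
      let ?z = "Complex (Re z) (Y n)"
      have "?r1 < (Y n / 2)\<^sup>2"
      proof -
        have "1 + ?r1 \<le> Y n / 2" using z by (simp add: Y_def)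
        then have "(1 + ?r1)\<^sup>2 \<le> (Y n / 2)\<^sup>2" by (intro power_mono) auto
        moreover have "(1 + ?r1)\<^sup>2 = 1 + 2 * ?r1 + ?r1 * ?r1" by (simp add: power2_eq_square algebra_simps)
        ultimately show ?thesis
          using measure_nonneg[of \<rho>1 UNIV] mult_nonneg_nonneg[OF measure_nonneg measure_nonneg, of \<rho>1 UNIV \<rho>1 UNIV]
          by linarith
      qed
      then have "Y n / 2 \<le> Im (\<phi> ?z)" using half[of ?z] Y(3)[of n] by simp
      then have "cmod (\<phi> ?z - ?z) \<le> \<bar>m1 - m2\<bar> + ?r2 / Y n + ?r1 / (1 / 2)"
        using disp[of ?z "1 / 2"] Y(3)[of n] by simp
      also have "\<dots> \<le> D"
      proof -
        have "?r2 / Y n \<le> ?r2 / 1" using Y(3)[of n] by (intro divide_left_mono) auto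
        then show ?thesis by (simp add: D_def)
      qed
      finally have "Y n - D \<le> Im (\<phi> ?z)"
        using abs_Im_le_cmod[of "\<phi> ?z - ?z"] by simp
      then have "Im z * (Y n - D) \<le> Im z * Im (\<phi> ?z)" using z by (intro mult_left_mono) auto
      also have "\<dots> \<le> Y n * Im (\<phi> (Complex (Re z) (Im z)))"
        by (rule vertical_harnack(1)[OF hol_\<phi> _ z Y(2)]) (use \<phi>(1) in \<open>auto intro: less_imp_le\<close>)
      finally have "Im z * (Y n - D) / Y n \<le> Im (\<phi> z)"
        using Y(3)[of n] by (simp add: divide_le_eq mult.commute)
      then show ?thesis using Y(3)[of n] by (simp add: diff_divide_distrib right_diff_distrib)
    qed
    moreover have "(\<lambda>n. Im z - Im z * D / Y n) \<longlonglongrightarrow> Im z - 0"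
      unfolding Y_def by (intro tendsto_diff tendsto_const) real_asymp
    ultimately show ?thesis using LIMSEQ_le_const2 by fastforce
  qed
  have disp': "cmod (\<phi> z - z) \<le> \<bar>m1 - m2\<bar> + (?r1 + ?r2) / Im z" if "0 < Im z" for z
    using disp[OF that that Im_le[OF that]] by (simp add: add_divide_distrib)
  \<comment> \<open>an increasing function of \<open>y\<close> is bounded by its limit at infinity\<close>
  have gap: "y * (Im (\<phi> (Complex 0 y)) - y) \<le> ?r2 - ?r1" if y: "0 < y" for y
  proof -
    define Y where "Y n = y + real n" for n
    have Y: "0 < Y n" "y \<le> Y n" for n using y by (auto simp: Y_def)
    have Ylim: "filterlim Y at_top sequentially" unfolding Y_def by real_asymp
    let ?h = "\<lambda>z. \<phi> z - z"
    have "y * Im (?h (Complex 0 y)) \<le> Y n * Im (?h (Complex 0 (Y n)))" for n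
      by (rule vertical_harnack(2)[OF _ _ y Y(2)]) (auto intro!: holomorphic_intros hol_\<phi> Im_le)
    moreover have "(\<lambda>n. Y n * Im (?h (Complex 0 (Y n)))) \<longlonglongrightarrow> ?r2 - ?r1"
    proof -
      have "(\<lambda>n. Y n * Im (?S2 (Complex 0 (Y n)))) \<longlonglongrightarrow> ?r2"
        using Y by (intro M2.stieltjes_asymptotics[OF Ylim, where C = 0]) (auto simp: Complex_eq)
      moreover have "(\<lambda>n. Y n * Im (?S1 (\<phi> (Complex 0 (Y n))))) \<longlonglongrightarrow> ?r1"
      proof (rule M1.stieltjes_asymptotics[OF Ylim, where C = "\<bar>m1 - m2\<bar> + (?r1 + ?r2) / y"])
        fix n
        have "cmod (\<phi> (Complex 0 (Y n)) - Complex 0 (Y n)) \<le> \<bar>m1 - m2\<bar> + (?r1 + ?r2) / Y n"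
          using disp'[of "Complex 0 (Y n)"] Y by simp
        also have "\<dots> \<le> \<bar>m1 - m2\<bar> + (?r1 + ?r2) / y"
          using Y[of n] y by (intro add_left_mono divide_left_mono) auto
        finally show "cmod (\<phi> (Complex 0 (Y n)) - \<i> * of_real (Y n)) \<le> \<bar>m1 - m2\<bar> + (?r1 + ?r2) / y"
          by (simp add: Complex_eq)
        show "Y n \<le> Im (\<phi> (Complex 0 (Y n)))" using Im_le[of "Complex 0 (Y n)"] Y by simp
      qed (rule Y)
      ultimately have "(\<lambda>n. Y n * Im (?S2 (Complex 0 (Y n))) - Y n * Im (?S1 (\<phi> (Complex 0 (Y n))))) \<longlonglongrightarrow> ?r2 - ?r1"
        by (rule tendsto_diff)
      then show ?thesis using Y(1) by (simp add: \<phi>_eq right_diff_distrib)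
    qed
    ultimately show ?thesis using LIMSEQ_le_const by fastforce
  qed
  show ?thesis by (rule that[of \<phi>]) (use Im_le \<phi>(2) disp' gap in auto)
qed

text \<open>Taking imaginary parts in \<open>f1(w) = f2(iy)\<close> for \<open>w = \<phi>(iy)\<close> turns the bound on
\<open>y (Im w - y)\<close> into \<open>r1 - y Im S1(w) \<le> r2 - y Im S2(iy)\<close>, where \<open>r1\<close>, \<open>r2\<close> are the masses and
\<open>S1\<close>, \<open>S2\<close> the transforms of the two measures. The left-hand side controls the tail of \<open>\<rho>1\<close>
because \<open>w\<close> lies within distance \<open>C\<close> of \<open>iy\<close>.\<close>

lemma
  assumes fin: "finite_borel_measure \<rho>1" "finite_borel_measure \<rho>2"
    and rep1: "\<And>z. 0 < Im z \<Longrightarrow> f1 z = z - complex_of_real m1 + stieltjes \<rho>1 z"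
    and rep2: "\<And>z. 0 < Im z \<Longrightarrow> f2 z = z - complex_of_real m2 + stieltjes \<rho>2 z"
    and inj: "inj_on f1 upper_half_plane"
    and range: "f2 ` upper_half_plane \<subseteq> f1 ` upper_half_plane"
  shows subordinate_mass_le: "measure \<rho>1 UNIV \<le> measure \<rho>2 UNIV"
    and subordinate_tail_le: "1 \<le> y \<Longrightarrow> \<bar>m1 - m2\<bar> + 2 * measure \<rho>2 UNIV \<le> C \<Longrightarrow>
      measure \<rho>1 {x. 2 * C + y \<le> \<bar>x\<bar>}
        \<le> 2 * (measure \<rho>2 UNIV - y * Im (stieltjes \<rho>2 (Complex 0 y)))"
proof -
  let ?r1 = "measure \<rho>1 UNIV" and ?r2 = "measure \<rho>2 UNIV"
  obtain \<phi> where \<phi>: "\<And>z. 0 < Im z \<Longrightarrow> Im z \<le> Im (\<phi> z)" "\<And>z. 0 < Im z \<Longrightarrow> f1 (\<phi> z) = f2 z"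
    and disp: "\<And>z. 0 < Im z \<Longrightarrow> cmod (\<phi> z - z) \<le> \<bar>m1 - m2\<bar> + (?r1 + ?r2) / Im z"
    and gap: "\<And>y. 0 < y \<Longrightarrow> y * (Im (\<phi> (Complex 0 y)) - y) \<le> ?r2 - ?r1"
    using subordination[OF assms] by blast
  show mass: "?r1 \<le> ?r2" using gap[of 1] \<phi>(1)[of "Complex 0 1"] by simp
  show "measure \<rho>1 {x. 2 * C + y \<le> \<bar>x\<bar>} \<le> 2 * (?r2 - y * Im (stieltjes \<rho>2 (Complex 0 y)))"
    if y: "1 \<le> y" and C: "\<bar>m1 - m2\<bar> + 2 * ?r2 \<le> C"
  proof -
    let ?w = "\<phi> (Complex 0 y)"
    have w: "y \<le> Im ?w" using \<phi>(1)[of "Complex 0 y"] y by simp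
    have "cmod (?w - Complex 0 y) \<le> \<bar>m1 - m2\<bar> + (?r1 + ?r2) / y"
      using disp[of "Complex 0 y"] y by simp
    also have "\<dots> \<le> \<bar>m1 - m2\<bar> + (?r2 + ?r2) / 1"
      using y mass by (intro add_left_mono frac_le) auto
    also have "\<dots> \<le> C" using C by simp
    finally have "\<bar>Re ?w\<bar> + Im ?w \<le> 2 * C + y"
      using abs_Re_le_cmod[of "?w - Complex 0 y"] abs_Im_le_cmod[of "?w - Complex 0 y"] by simp
    then have "measure \<rho>1 {x. 2 * C + y \<le> \<bar>x\<bar>} \<le> 2 * (?r1 - y * Im (stieltjes \<rho>1 ?w))"
      using y w by (intro finite_borel_measure.tail_le_poisson_deficit[OF fin(1)]) auto
    moreover have "Im ?w + Im (stieltjes \<rho>1 ?w) = y + Im (stieltjes \<rho>2 (Complex 0 y))"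
      using \<phi>(2)[of "Complex 0 y"] rep1[of ?w] rep2[of "Complex 0 y"] y w
      by (simp add: complex_eq_iff)
    then have "y * Im (stieltjes \<rho>2 (Complex 0 y)) - y * Im (stieltjes \<rho>1 ?w) = y * (Im ?w - y)"
      by (simp add: right_diff_distrib[symmetric])
    ultimately show ?thesis using gap[of y] y by simp
  qed
qed

section \<open>Representing pairs and Loewner chains\<close>

lemma P2_represents:
  assumes "f \<in> P2"
  shows "\<exists>p. represents f p"
proof -
  obtain \<mu> where \<mu>: "real_distribution \<mu>" and sq: "integrable \<mu> (\<lambda>x. x\<^sup>2)"
    and f: "\<And>z. z \<in> upper_half_plane \<Longrightarrow> f z = reciprocal_cauchy_transform \<mu> z"
    using assms by (auto simp: P2_def)
  interpret real_distribution \<mu> by (rule \<mu>)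
  define m where "m = integral\<^sup>L \<mu> (\<lambda>x. x)"
  define h where "h z = - 1 / stieltjes \<mu> z - z + complex_of_real m" for z
  have nz: "stieltjes \<mu> z \<noteq> 0" if "0 < Im z" for z using Im_stieltjes_pos[OF that] by auto
  have "h holomorphic_on upper_half_plane"
    unfolding h_def
    by (intro holomorphic_intros holomorphic_stieltjes) (auto simp: upper_half_plane_def nz)
  moreover have "0 \<le> Im (h z)" "cmod (h z) \<le> (LINT x|\<mu>. (x - m)\<^sup>2) / Im z" if "0 < Im z" for z
    using maassen_bound[OF sq that] by (simp_all add: h_def m_def)
  ultimately obtain \<rho> c where \<rho>: "finite_borel_measure \<rho>"
    and h: "\<And>z. z \<in> upper_half_plane \<Longrightarrow> h z = stieltjes \<rho> z + complex_of_real c"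
    using nevanlinna_representation by metis
  have "f z = z - complex_of_real (m - c) + stieltjes \<rho> z" if "z \<in> upper_half_plane" for z
  proof -
    have "f z = - 1 / stieltjes \<mu> z"
      using f[OF that] by (simp add: reciprocal_cauchy_transform_def cauchy_transform_eq_stieltjes)
    then have "f z = h z + z - of_real m" by (simp add: h_def)
    then show ?thesis by (simp add: h[OF that])
  qed
  then have "represents f (m - c, \<rho>)" using \<rho> by (simp add: represents_def stieltjes_def)
  then show ?thesis by blast
qed

lemma represents_unique:
  assumes p: "represents f p" and q: "represents f q"
  shows "p = q"
proof -
  obtain m \<rho> where p_eq: "p = (m, \<rho>)" by (cases p)
  obtain n \<nu> where q_eq: "q = (n, \<nu>)" by (cases q)
  have fin: "finite_borel_measure \<rho>" "finite_borel_measure \<nu>"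
    and f: "\<And>z. 0 < Im z \<Longrightarrow> f z = z - of_real m + stieltjes \<rho> z"
      "\<And>z. 0 < Im z \<Longrightarrow> f z = z - of_real n + stieltjes \<nu> z"
    using p q by (auto simp: represents_def stieltjes_def upper_half_plane_def p_eq q_eq)
  have eq: "stieltjes \<rho> z - of_real m = stieltjes \<nu> z - of_real n" if "0 < Im z" for z
    using f(1)[OF that] f(2)[OF that] by (simp add: algebra_simps)
  have "\<rho> = \<nu>"
  proof (rule stieltjes_inject[OF fin])
    fix z :: complex assume "0 < Im z"
    from arg_cong[OF eq[OF this], of Im] show "Im (stieltjes \<rho> z) = Im (stieltjes \<nu> z)" by simp
  qed
  moreover from this have "m = n" using eq[of \<i>] by simp
  ultimately show ?thesis by (simp add: p_eq q_eq)
qed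

lemma
  assumes "f \<in> P2"
  shows finite_borel_measure_rho_of: "finite_borel_measure (rho_of f)"
    and P2_eq: "0 < Im z \<Longrightarrow> f z = z - complex_of_real (mean_of f) + stieltjes (rho_of f) z"
proof -
  have "\<exists>!p. represents f p" using P2_represents[OF assms] represents_unique by blast
  then have "represents f (THE p. represents f p)" by (rule theI')
  then have "represents f (mean_of f, rho_of f)" by (simp add: mean_of_def rho_of_def)
  then show "finite_borel_measure (rho_of f)"
    "0 < Im z \<Longrightarrow> f z = z - complex_of_real (mean_of f) + stieltjes (rho_of f) z"
    by (auto simp: represents_def stieltjes_def upper_half_plane_def)
qed

lemma loewner_chain_subordinate:
  assumes chain: "decreasing_loewner_chain_P2 I f" and st: "s \<in> I" "t \<in> I" "s \<le> t"
  shows "measure (rho_of (f s)) UNIV \<le> measure (rho_of (f t)) UNIV"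
    and "1 \<le> y \<Longrightarrow> \<bar>mean_of (f s) - mean_of (f t)\<bar> + 2 * measure (rho_of (f t)) UNIV \<le> C \<Longrightarrow>
      measure (rho_of (f s)) {x. 2 * C + y \<le> \<bar>x\<bar>}
        \<le> 2 * (measure (rho_of (f t)) UNIV - y * Im (stieltjes (rho_of (f t)) (Complex 0 y)))"
proof -
  have P2: "f s \<in> P2" "f t \<in> P2" and inj: "inj_on (f s) upper_half_plane"
    and range: "f t ` upper_half_plane \<subseteq> f s ` upper_half_plane"
    using chain st by (auto simp: decreasing_loewner_chain_P2_def)
  note sub = finite_borel_measure_rho_of[OF P2(1)] finite_borel_measure_rho_of[OF P2(2)]
    P2_eq[OF P2(1)] P2_eq[OF P2(2)] inj range
  show "measure (rho_of (f s)) UNIV \<le> measure (rho_of (f t)) UNIV"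
    by (rule subordinate_mass_le[OF sub])
  show "measure (rho_of (f s)) {x. 2 * C + y \<le> \<bar>x\<bar>}
        \<le> 2 * (measure (rho_of (f t)) UNIV - y * Im (stieltjes (rho_of (f t)) (Complex 0 y)))"
    if "1 \<le> y" "\<bar>mean_of (f s) - mean_of (f t)\<bar> + 2 * measure (rho_of (f t)) UNIV \<le> C"
    by (rule subordinate_tail_le[OF sub that])
qed

lemma loewner_chain_pointwise:
  assumes chain: "decreasing_loewner_chain_P2 I f" and t: "t \<in> I"
    and X: "\<And>n. X n \<in> I" "X \<longlonglongrightarrow> t" and z: "0 < Im z"
  shows "(\<lambda>n. f (X n) z) \<longlonglongrightarrow> f t z"
proof -
  have "uniform_limit {z} f (f t) (at t within I)"
    using chain t z unfolding decreasing_loewner_chain_P2_def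
    by (metis (no_types, lifting) compact_sing empty_subsetI insert_subset mem_Collect_eq upper_half_plane_def)
  then have "((\<lambda>s. f s z) \<longlongrightarrow> f t z) (at t within I)"
    by (rule tendsto_uniform_limitI) simp
  then have "continuous (at t within I) (\<lambda>s. f s z)" by (simp add: continuous_within)
  then show ?thesis using X unfolding continuous_within_sequentially by (auto simp: o_def)
qed

text \<open>The time \<open>t1\<close> dominates the sequence, so that its measure controls all masses and tails. The tail
bound also involves the means; they are bounded because \<open>f\<^sub>s(i)\<close> converges and
\<open>|S\<^sub>s(i)| \<le> R\<close> for the transform \<open>S\<^sub>s\<close> of \<open>\<rho>\<^sub>s\<close>.\<close>

lemma loewner_chain_weak_convergence:
  fixes g :: "real \<Rightarrow> real"
  assumes chain: "decreasing_loewner_chain_P2 I f" and t: "t \<in> I" "t \<le> t1" "t1 \<in> I"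
    and X: "\<And>n. X n \<in> I" "\<And>n. X n \<le> t1" "X \<longlonglongrightarrow> t"
    and cont: "continuous_on UNIV g" and B: "\<And>x. \<bar>g x\<bar> \<le> B"
  shows "(\<lambda>n. integral\<^sup>L (rho_of (f (X n))) g) \<longlonglongrightarrow> integral\<^sup>L (rho_of (f t)) g"
proof -
  let ?\<rho> = "\<lambda>t. rho_of (f t)" and ?m = "\<lambda>t. mean_of (f t)"
  have P2: "f s \<in> P2" if "s \<in> I" for s
    using chain that by (auto simp: decreasing_loewner_chain_P2_def)
  define R where "R = measure (?\<rho> t1) UNIV"
  have fin: "finite_borel_measure (?\<rho> s)" if "s \<in> I" for s
    by (rule finite_borel_measure_rho_of[OF P2[OF that]])
  have eq: "f s z = z - of_real (?m s) + stieltjes (?\<rho> s) z" if "s \<in> I" "0 < Im z" for s z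
    by (rule P2_eq[OF P2[OF that(1)] that(2)])
  have mass: "measure (?\<rho> (X n)) UNIV \<le> R" for n
    unfolding R_def by (rule loewner_chain_subordinate(1)[OF chain X(1) t(3) X(2)])
  note pw = loewner_chain_pointwise[OF chain t(1) X(1,3)]

  have "Bseq (\<lambda>n. f (X n) \<i>)" using pw[of \<i>] by (intro convergent_imp_Bseq) (auto simp: convergent_def)
  then obtain A where A: "\<And>n. cmod (f (X n) \<i>) \<le> A" by (auto simp: Bseq_def)
  define C where "C = 1 + R + A + \<bar>?m t1\<bar> + 2 * R"
  have mean: "\<bar>?m (X n) - ?m t1\<bar> + 2 * R \<le> C" for n
  proof -
    have "?m (X n) = Re (stieltjes (?\<rho> (X n)) \<i>) - Re (f (X n) \<i>)"
      using eq[OF X(1), of \<i> n] by simp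
    moreover have "cmod (stieltjes (?\<rho> (X n)) \<i>) \<le> R"
      using finite_borel_measure.norm_stieltjes_le[OF fin[OF X(1)], of 1 \<i> n] mass[of n] by simp
    ultimately show ?thesis
      using abs_Re_le_cmod[of "stieltjes (?\<rho> (X n)) \<i>"] abs_Re_le_cmod[of "f (X n) \<i>"] A[of n]
      unfolding C_def by linarith
  qed
  show ?thesis
  proof (rule weak_convergence_of_stieltjes[where \<rho> = "\<lambda>n. ?\<rho> (X n)", OF _ fin[OF t(1)] mass _ _ cont B])
    show "finite_borel_measure (?\<rho> (X n))" for n by (rule fin[OF X(1)])
    show "(\<lambda>n. Im (stieltjes (?\<rho> (X n)) z)) \<longlonglongrightarrow> Im (stieltjes (?\<rho> t) z)" if z: "0 < Im z" for z
    proof -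
      have "(\<lambda>n. Im (f (X n) z) - Im z) \<longlonglongrightarrow> Im (f t z) - Im z"
        by (intro tendsto_intros pw z)
      then show ?thesis using z by (simp add: eq X(1) t(1))
    qed
    show "\<exists>K. \<forall>n. measure (?\<rho> (X n)) {x. K \<le> \<bar>x\<bar>} \<le> \<eta>" if \<eta>: "0 < \<eta>" for \<eta>
    proof -
      let ?y = "\<lambda>n. real (Suc n)"
      have "(\<lambda>n. ?y n * Im (stieltjes (?\<rho> t1) (Complex 0 (?y n)))) \<longlonglongrightarrow> R"
        unfolding R_def
      proof (rule finite_borel_measure.stieltjes_asymptotics[OF fin[OF t(3)], where C = 0])
        show "filterlim ?y at_top sequentially" by real_asymp
      qed (auto simp: Complex_eq)
      moreover have "R - \<eta> / 2 < R" using \<eta> by simp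
      ultimately have "\<forall>\<^sub>F n in sequentially. R - \<eta> / 2 < ?y n * Im (stieltjes (?\<rho> t1) (Complex 0 (?y n)))"
        by (rule order_tendstoD)
      then obtain k where k: "R - \<eta> / 2 < ?y k * Im (stieltjes (?\<rho> t1) (Complex 0 (?y k)))"
        by (auto simp: eventually_sequentially)
      have "measure (?\<rho> (X n)) {x. 2 * C + ?y k \<le> \<bar>x\<bar>} \<le> \<eta>" for n
        using loewner_chain_subordinate(2)[OF chain X(1) t(3) X(2), of "?y k" n C] mean[of n] k
        by (simp add: R_def)
      then show ?thesis by blast
    qed
  qed
qed

lemma loewner_chain_sequential:
  fixes g :: "real \<Rightarrow> real"
  assumes chain: "decreasing_loewner_chain_P2 I f" and t: "t \<in> I"
    and X: "\<And>n. X n \<in> I" "X \<longlonglongrightarrow> t"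
    and cont: "continuous_on UNIV g" and B: "\<And>x. \<bar>g x\<bar> \<le> B"
  shows "(\<lambda>n. integral\<^sup>L (rho_of (f (X n))) g) \<longlonglongrightarrow> integral\<^sup>L (rho_of (f t)) g"
proof -
  \<comment> \<open>a time in \<open>I\<close> that eventually dominates the sequence: one after \<open>t\<close>, or \<open>t\<close> if it is the last\<close>
  obtain t1 N where t1: "t1 \<in> I" "t \<le> t1" "\<And>n. n \<ge> N \<Longrightarrow> X n \<le> t1"
  proof (cases "\<exists>t1\<in>I. t < t1")
    case True
    then obtain t1 where t1: "t1 \<in> I" "t < t1" by blast
    then obtain N where "\<And>n. n \<ge> N \<Longrightarrow> X n < t1"
      using order_tendstoD(2)[OF X(2), of t1] by (auto simp: eventually_sequentially)
    then show ?thesis using that[of t1 N] t1 by (auto intro: less_imp_le)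
  next
    case False
    then have "X n \<le> t" for n using X(1)[of n] by (meson not_le)
    then show ?thesis using that[of t 0] t by auto
  qed
  have "(\<lambda>n. integral\<^sup>L (rho_of (f (X (n + N)))) g) \<longlonglongrightarrow> integral\<^sup>L (rho_of (f t)) g"
    by (rule loewner_chain_weak_convergence[OF chain t t1(2,1) _ _ _ cont B])
       (use X t1(3) in \<open>auto intro: LIMSEQ_ignore_initial_segment\<close>)
  then show ?thesis by (rule LIMSEQ_offset)
qed

theorem theorem1p10:
  fixes I :: "real set" and f :: "real \<Rightarrow> complex \<Rightarrow> complex"
  assumes "time_interval I"
    and "decreasing_loewner_chain_P2 I f"
  shows "continuous_on I (\<lambda>t. mean_of (f t)) \<and>
         weakly_continuous_on I (\<lambda>t. rho_of (f t)) \<and>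
         continuous_on I (\<lambda>t. r_of (f t))"
proof -
  note chain = assms(2)
  have P2: "f t \<in> P2" if "t \<in> I" for t
    using chain that by (auto simp: decreasing_loewner_chain_P2_def)
  have fin: "finite_borel_measure (rho_of (f t))" if "t \<in> I" for t
    by (rule finite_borel_measure_rho_of[OF P2[OF that]])
  have weak: "continuous_on I (\<lambda>t. integral\<^sup>L (rho_of (f t)) g)"
    if "continuous_on UNIV g" "\<And>x. \<bar>g x\<bar> \<le> B" for g :: "real \<Rightarrow> real" and B
    unfolding continuous_on_sequentially o_def
    using loewner_chain_sequential[OF chain _ _ _ that] by blast
  have "continuous_on I (\<lambda>t. mean_of (f t))"
  proof -
    let ?g = "\<lambda>x. Re (1 / (complex_of_real x - \<i>))"
    have g: "continuous_on UNIV ?g" by (intro continuous_intros continuous_on_resolvent) simp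
    have g_bound: "\<bar>?g x\<bar> \<le> 1" for x
      using order_trans[OF abs_Re_le_cmod norm_resolvent_le[of 1 \<i> x]] by simp
    have "continuous_on I (\<lambda>t. f t \<i>)"
      unfolding continuous_on_sequentially o_def
      using loewner_chain_pointwise[OF chain, where z = \<i>] by auto
    then have "continuous_on I (\<lambda>t. integral\<^sup>L (rho_of (f t)) ?g - Re (f t \<i>))"
      by (intro continuous_intros weak[OF g g_bound])
    moreover have "integral\<^sup>L (rho_of (f t)) ?g - Re (f t \<i>) = mean_of (f t)" if "t \<in> I" for t
    proof -
      have "integral\<^sup>L (rho_of (f t)) ?g = Re (stieltjes (rho_of (f t)) \<i>)"
        unfolding stieltjes_def
        by (rule integral_Re[OF finite_borel_measure.integrable_resolvent[OF fin[OF that]]]) simp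
      then show ?thesis using P2_eq[OF P2[OF that], of \<i>] by simp
    qed
    ultimately show ?thesis by (simp cong: continuous_on_cong)
  qed
  moreover have "weakly_continuous_on I (\<lambda>t. rho_of (f t))"
    unfolding weakly_continuous_on_def
  proof (intro conjI ballI allI impI fin)
    fix g :: "real \<Rightarrow> real" assume g: "continuous_on UNIV g \<and> bounded (range g)"
    then obtain B where "\<And>x. \<bar>g x\<bar> \<le> B" by (auto simp: bounded_iff)
    then show "continuous_on I (\<lambda>t. integral\<^sup>L (rho_of (f t)) g)" using g weak by blast
  qed
  moreover have "continuous_on I (\<lambda>t. r_of (f t))"
  proof -
    have "continuous_on I (\<lambda>t. integral\<^sup>L (rho_of (f t)) (\<lambda>_. 1 :: real))"
      by (rule weak[of _ 1]) auto
    moreover have "integral\<^sup>L (rho_of (f t)) (\<lambda>_. 1 :: real) = r_of (f t)" if "t \<in> I" for t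
      by (simp add: r_of_def finite_borel_measure.borel_UNIV[OF fin[OF that]])
    ultimately show ?thesis by (simp cong: continuous_on_cong)
  qed
  ultimately show ?thesis by blast
qed

end
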